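(* Let $Y$ be a mean zero random variable with variance $\sigma^2\in(0,\infty)$, and let $Y^*$ be defined on the same probability space as $Y$ and have the $Y$-zero biased distribution. Suppose $|Y^*-Y|\le 2B$ for some constant $B\le \sigma/24$. Let $W=Y/\sigma$, let $\mathcal{H}$ be a class of functions satisfying (i), (ii), (iii) of the context with constant $a$, and let $\delta=\sup_{h\in\mathcal{H}}|E h(W)-Nh|$. Then, with $A=2B/\sigma$, $$\delta\le A\,(37+12A+112a).$$ Moreover, when $\mathcal{H}$ is the collection of indicators of all half lines (using $a=\sqrt{2/\pi}$), and when $\mathcal{H}$ is the collection of indicators of all intervals (using $a=2\sqrt{2/\pi}$), we have respectively $$\delta\le A(127+12A)\qquad\text{and}\qquad \delta\le A(216+12A).$$
   Context: Zero bias: for a random variable $Y$ with mean zero and variance $\sigma^2\in(0,\infty)$, a random variable $Y^*$ has the $Y$-zero biased distribution if $E[Yf(Y)]=\sigma^2E[f'(Y^* )]$ for all absolutely continuous functions $f$ for which the expectation of either side exists. $Nh=E h(Z)$ where $Z\sim\mathcal{N}(0,1)$. $\mathcal{H}$ is a class of measurable functions on the real line such that: (i) the functions $h\in\mathcal{H}$ are uniformly bounded in absolute value by $1$; (ii) for any real numbers $c,d$ and any $h\in\mathcal{H}$, the function $x\mapsto h(cx+d)$ is in $\mathcal{H}$; (iii) for any $\epsilon>0$ and $h\in\mathcal{H}$, the functions $h^+_\epsilon(x)=\sup_{|y|\le\epsilon}h(x+y)$ and $h^-_\epsilon(x)=\inf_{|y|\le\epsilon}h(x+y)$ are also in $\mathcal{H}$,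 and, with $\tilde h_\epsilon=h^+_\epsilon-h^-_\epsilon$, $E\tilde h_\epsilon(Z)\le a\epsilon$ for some constant $a$ depending only on the class $\mathcal{H}$. *)

theory Defs
  imports "HOL-Probability.Probability"
begin

definition absolutely_continuous_fun_on :: "real \<Rightarrow> real \<Rightarrow> (real \<Rightarrow> real) \<Rightarrow> bool" where
  "absolutely_continuous_fun_on a b f \<longleftrightarrow>
     (\<forall>\<epsilon>>0. \<exists>\<eta>>0. \<forall>(n::nat) u v.
        (\<forall>i<n. a \<le> u i \<and> u i \<le> v i \<and> v i \<le> b) \<and>
        (\<forall>i<n. \<forall>j<n. i \<noteq> j \<longrightarrow> {u i<..<v i} \<inter> {u j<..<v j} = {}) \<and>
        (\<Sum>i<n. v i - u i) < \<eta> \<longrightarrow>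
        (\<Sum>i<n. \<bar>f (v i) - f (u i)\<bar>) < \<epsilon>)"

(* On the whole real line: absolutely continuous on every compact interval. *)
definition absolutely_continuous_fun :: "(real \<Rightarrow> real) \<Rightarrow> bool" where
  "absolutely_continuous_fun f \<longleftrightarrow> (\<forall>a b. absolutely_continuous_fun_on a b f)"

(* Ys has the Y-zero biased distribution; Y is meant to have mean 0 and variance in (0,\<infinity>).

   The derivative of an absolutely continuous f exists Lebesgue-almost everywhere.  The identity for
   continuously differentiable f already forces the law of Ys to have a density, so the value
   that deriv assigns at points of non-differentiability is irrelevant.

   The identity is required for those f for which both expectations exist.  Requiring it as soon as
   one of them exists cannot be met in general: if Y is unbounded and integer valued, an f that
   vanishes on the integers and oscillates enough in between has E[Y f(Y)] = 0 while f'(Ys) is not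
   integrable.  Since both sides exist whenever f' is bounded, the law of Ys is determined anyway. *)
definition zero_biased :: "'a measure \<Rightarrow> ('a \<Rightarrow> real) \<Rightarrow> ('a \<Rightarrow> real) \<Rightarrow> bool" where
  "zero_biased M Y Ys \<longleftrightarrow>
     Ys \<in> borel_measurable M \<and>
     (\<forall>f. absolutely_continuous_fun f \<and>
          integrable M (\<lambda>\<omega>. Y \<omega> * f (Y \<omega>)) \<and> integrable M (\<lambda>\<omega>. deriv f (Ys \<omega>)) \<longrightarrow>
          prob_space.expectation M (\<lambda>\<omega>. Y \<omega> * f (Y \<omega>)) =
          prob_space.variance M Y * prob_space.expectation M (\<lambda>\<omega>. deriv f (Ys \<omega>)))"

definition normal_expectation :: "(real \<Rightarrow> real) \<Rightarrow> real" where
  "normal_expectation h = prob_space.expectation std_normal_distribution h"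

definition upper_env :: "real \<Rightarrow> (real \<Rightarrow> real) \<Rightarrow> real \<Rightarrow> real" where
  "upper_env \<epsilon> h x = (SUP y\<in>{y. \<bar>y\<bar> \<le> \<epsilon>}. h (x + y))"

definition lower_env :: "real \<Rightarrow> (real \<Rightarrow> real) \<Rightarrow> real \<Rightarrow> real" where
  "lower_env \<epsilon> h x = (INF y\<in>{y. \<bar>y\<bar> \<le> \<epsilon>}. h (x + y))"

(* Non-emptiness is required because the supremum of the empty set of reals is unspecified. *)
definition test_class :: "(real \<Rightarrow> real) set \<Rightarrow> real \<Rightarrow> bool" where
  "test_class H a \<longleftrightarrow>
     H \<noteq> {} \<and>
     H \<subseteq> borel_measurable borel \<and>
     (\<forall>h\<in>H. \<forall>x. \<bar>h x\<bar> \<le> 1) \<and>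
     (\<forall>h\<in>H. \<forall>c d. (\<lambda>x. h (c * x + d)) \<in> H) \<and>
     (\<forall>\<epsilon>>0. \<forall>h\<in>H. upper_env \<epsilon> h \<in> H \<and> lower_env \<epsilon> h \<in> H \<and>
        normal_expectation (\<lambda>x. upper_env \<epsilon> h x - lower_env \<epsilon> h x) \<le> a * \<epsilon>)"

definition normal_distance ::
    "'a measure \<Rightarrow> ('a \<Rightarrow> real) \<Rightarrow> (real \<Rightarrow> real) set \<Rightarrow> real" where
  "normal_distance M W H =
     (SUP h\<in>H. \<bar>prob_space.expectation M (\<lambda>\<omega>. h (W \<omega>)) - normal_expectation h\<bar>)"

definition half_line_indicators :: "(real \<Rightarrow> real) set" where
  "half_line_indicators =
     range (\<lambda>z. indicat_real {..z}) \<union> range (\<lambda>z. indicat_real {..<z}) \<union>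
     range (\<lambda>z. indicat_real {z..}) \<union> range (\<lambda>z. indicat_real {z<..})"

(* The constants are the degenerate half lines, the empty set and the whole line; closure under
   x \<mapsto> c x + d with c = 0 requires them.  They contribute 0 to normal_distance. *)
definition extended_half_line_indicators :: "(real \<Rightarrow> real) set" where
  "extended_half_line_indicators = half_line_indicators \<union> {\<lambda>_. 0, \<lambda>_. 1}"

(* All intervals: open, closed, half open, unbounded, degenerate or empty. *)
definition interval_indicators :: "(real \<Rightarrow> real) set" where
  "interval_indicators = {indicat_real S | S. is_interval S}"

end

theory Submission
  imports Defs
begin

text \<open>
  Stein's method turns closeness of \<open>Y\<close> and \<open>Y\<^sup>*\<close> into closeness of \<open>W\<close> to the normal law. Put
  \<open>V = Y\<^sup>*/\<sigma>\<close>, so that \<open>\<bar>V - W\<bar> \<le> A\<close> almost surely, and let \<open>f\<close> solve Stein's equation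
  \<open>f'(w) - w f(w) = g(w) - N g\<close> for a continuous test function \<open>g\<close>. The zero bias identity
  \<open>E (W f(W)) = E f'(V)\<close> gives \<open>E g(W) - N g = E (f'(W) - f'(V))\<close>, and replacing \<open>f'\<close> by means of
  Stein's equation splits the right-hand side into \<open>E (W f(W) - V f(V))\<close>, which is at most \<open>14 A\<close>
  because \<open>f\<close> and \<open>f'\<close> are bounded, and \<open>E (g(W) - g(V))\<close> (lemma \<open>zero_bias_stein_bound\<close>).

  The functions in the class need not be continuous, so \<open>h\<close> is replaced by its average over
  \<open>[x - t, x + t]\<close>. A function differs from its average by at most the gap between its upper and
  lower envelopes of radius \<open>t\<close>; since the envelopes belong to the class again, the replacement
  costs only \<open>2 a t\<close> (lemma \<open>smoothing_inequality\<close>). The average changes between \<open>W\<close> and \<open>V\<close> by at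
  most \<open>A / (2 t)\<close> times the envelope gap of radius \<open>t + A\<close> at \<open>W\<close>. Under the normal law the gap
  has mean at most \<open>a (t + A)\<close>, hence under the law of \<open>W\<close> at most \<open>a (t + A) + 2 \<delta>\<close>. So \<open>\<delta>\<close> is
  bounded in terms of itself:
  \<open>\<delta> \<le> 14 A + A / (2 t) * (a (t + A) + 2 \<delta>) + 2 a t\<close> (lemma \<open>zero_bias_recursion\<close>).
  With \<open>t = 2 A\<close> the coefficient of \<open>\<delta>\<close> on the right is \<open>1/2\<close>, and solving for \<open>\<delta>\<close> gives
  \<open>\<delta> \<le> A (28 + 19/2 a)\<close>, which is stronger than the three bounds claimed.

  For indicators of half lines and intervals the envelopes are indicators of the sets enlarged and
  shrunk by \<open>\<epsilon>\<close>. The gap lives within \<open>\<epsilon>\<close> of the end points, at most one or two in number, and the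
  normal density is at most \<open>1 / sqrt (2 pi)\<close>, which yields the constants \<open>a\<close>.
\<close>

section \<open>Moving averages and envelopes\<close>

definition moving_average :: "real \<Rightarrow> (real \<Rightarrow> real) \<Rightarrow> real \<Rightarrow> real" where
  "moving_average t h x = integral {x - t..x + t} h / (2 * t)"

lemma bounded_borel_integrable_on_interval:
  fixes h :: "real \<Rightarrow> real"
  assumes "h \<in> borel_measurable borel" "\<And>x. \<bar>h x\<bar> \<le> C"
  shows "h integrable_on {a..b}"
proof -
  have "h integrable_on cbox a b"
  proof (rule measurable_bounded_lemma)
    show "h \<in> borel_measurable lebesgue"
      using assms(1) by (simp add: measurable_completion)
    show "(\<lambda>_. C) integrable_on cbox a b"
      by (rule integrable_const)
  qed (simp add: assms(2))
  thus ?thesis by simp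
qed

lemma interval_integral_between:
  fixes h :: "real \<Rightarrow> real"
  assumes "h integrable_on {a..b}" "a \<le> b" "\<And>x. x \<in> {a..b} \<Longrightarrow> l \<le> h x \<and> h x \<le> u"
  shows "(b - a) * l \<le> integral {a..b} h" "integral {a..b} h \<le> (b - a) * u"
proof -
  have "integral {a..b} (\<lambda>_. l) \<le> integral {a..b} h"
    by (rule integral_le) (use assms in auto)
  thus "(b - a) * l \<le> integral {a..b} h" using \<open>a \<le> b\<close> by simp
  have "integral {a..b} h \<le> integral {a..b} (\<lambda>_. u)"
    by (rule integral_le) (use assms in auto)
  thus "integral {a..b} h \<le> (b - a) * u" using \<open>a \<le> b\<close> by simp
qed

lemma moving_average_between:
  assumes "h \<in> borel_measurable borel" "\<And>x. \<bar>h x\<bar> \<le> C" "t > 0"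
    and "\<And>y. \<bar>y - x\<bar> \<le> t \<Longrightarrow> l \<le> h y \<and> h y \<le> u"
  shows "l \<le> moving_average t h x" "moving_average t h x \<le> u"
proof -
  have "h integrable_on {x - t..x + t}"
    by (rule bounded_borel_integrable_on_interval) (use assms in auto)
  moreover have "l \<le> h y \<and> h y \<le> u" if "y \<in> {x - t..x + t}" for y
    using that by (intro assms(4)) auto
  ultimately have "(2 * t) * l \<le> integral {x - t..x + t} h"
    "integral {x - t..x + t} h \<le> (2 * t) * u"
    using interval_integral_between[of h "x - t" "x + t" l u] \<open>t > 0\<close> by simp_all
  thus "l \<le> moving_average t h x" "moving_average t h x \<le> u"
    using \<open>t > 0\<close> by (simp_all add: moving_average_def field_simps)
qed

text \<open>
  Shifting the window from \<open>x\<close> to \<open>x'\<close> drops a piece of length \<open>x' - x\<close> at one end and gains one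
  of the same length at the other. The two pieces nearly cancel when \<open>h\<close> oscillates little, which is
  why the bound carries the oscillation \<open>u - l\<close> and not just the bound on \<open>h\<close>.
\<close>

lemma moving_average_increment:
  assumes "h \<in> borel_measurable borel" "\<And>x. \<bar>h x\<bar> \<le> C" "t > 0" "x \<le> x'"
    and "\<And>y. y \<in> {x - t..x' + t} \<Longrightarrow> l \<le> h y \<and> h y \<le> u"
  shows "\<bar>moving_average t h x - moving_average t h x'\<bar> \<le> (x' - x) / (2 * t) * (u - l)"
proof -
  have int: "h integrable_on {a..b}" for a b
    by (rule bounded_borel_integrable_on_interval) (use assms in auto)
  have split: "integral {a..c} h = integral {a..b} h + integral {b..c} h" if "a \<le> b" "b \<le> c" for a b c
    using Henstock_Kurzweil_Integration.integral_combine[OF that int] by simp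
  \<comment> \<open>Both sides are the integral over the union of the two windows and the gap between them, if any;
    this way the overlapping and the disjoint case need no distinction.\<close>
  have "integral {x - t..x + t} h + integral {x + t..x' + t} h
      = integral {x - t..x' - t} h + integral {x' - t..x' + t} h"
    using split[of "x - t" "x + t" "x' + t"] split[of "x - t" "x' - t" "x' + t"] assms(3,4) by simp
  hence *: "integral {x - t..x + t} h - integral {x' - t..x' + t} h
      = integral {x - t..x' - t} h - integral {x + t..x' + t} h" by simp
  have "(x' - x) * l \<le> integral {x - t..x' - t} h" "integral {x - t..x' - t} h \<le> (x' - x) * u"
    using interval_integral_between[of h "x - t" "x' - t" l u] assms(3-5) int by simp_all
  moreover have "(x' - x) * l \<le> integral {x + t..x' + t} h" "integral {x + t..x' + t} h \<le> (x' - x) * u"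
    using interval_integral_between[of h "x + t" "x' + t" l u] assms(3-5) int by simp_all
  ultimately have "\<bar>integral {x - t..x + t} h - integral {x' - t..x' + t} h\<bar> \<le> (x' - x) * (u - l)"
    unfolding * by (simp add: right_diff_distrib abs_le_iff)
  moreover have "\<bar>moving_average t h x - moving_average t h x'\<bar>
      = \<bar>integral {x - t..x + t} h - integral {x' - t..x' + t} h\<bar> / (2 * t)"
    using \<open>t > 0\<close> by (simp add: moving_average_def flip: diff_divide_distrib)
  ultimately show ?thesis
    using \<open>t > 0\<close> by (simp add: divide_right_mono)
qed

lemma continuous_moving_average:
  assumes "h \<in> borel_measurable borel" "\<And>x. \<bar>h x\<bar> \<le> 1" "t > 0"
  shows "continuous_on UNIV (moving_average t h)"
proof -
  have *: "\<bar>moving_average t h x - moving_average t h y\<bar> \<le> (1 / t) * \<bar>x - y\<bar>" if "x \<le> y" for x y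
    proof -
    have "- 1 \<le> h z \<and> h z \<le> 1" for z using assms(2)[of z] by linarith
    hence "\<bar>moving_average t h x - moving_average t h y\<bar> \<le> (y - x) / (2 * t) * (1 - (- 1))"
      by (intro moving_average_increment[OF assms that]) auto
    moreover have "(y - x) / (2 * t) * (1 - (- 1)) = (y - x) / t" using \<open>t > 0\<close> by (simp add: field_simps)
    ultimately show ?thesis using that by simp
  qed
  have "(1 / t)-lipschitz_on UNIV (moving_average t h)"
  proof (rule lipschitz_onI)
    show "dist (moving_average t h x) (moving_average t h y) \<le> (1 / t) * dist x y" for x y
      using *[of x y] *[of y x] by (cases "x \<le> y") (auto simp: dist_real_def abs_minus_commute)
  qed (use assms in auto)
  thus ?thesis by (rule lipschitz_on_continuous_on)
qed

lemma env_bounds: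
  assumes "\<And>x. \<bar>h x\<bar> \<le> (1::real)" "\<bar>y - x\<bar> \<le> r"
  shows "lower_env r h x \<le> h y" "h y \<le> upper_env r h x"
proof -
  have "bdd_above ((\<lambda>y. h (x + y)) ` {y. \<bar>y\<bar> \<le> r})"
    by (rule bdd_aboveI2[where M = 1]) (use assms(1) in \<open>simp add: abs_le_iff\<close>)
  from cSUP_upper[OF _ this, of "y - x"] show "h y \<le> upper_env r h x"
    using assms(2) by (simp add: upper_env_def)
  have "bdd_below ((\<lambda>y. h (x + y)) ` {y. \<bar>y\<bar> \<le> r})"
    by (rule bdd_belowI2[where m = "-1"]) (use assms(1) in \<open>simp add: abs_le_iff minus_le_iff\<close>)
  from cINF_lower[OF this, of "y - x"] show "lower_env r h x \<le> h y"
    using assms(2) by (simp add: lower_env_def)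
qed

lemma env_least:
  assumes "r \<ge> 0"
  shows "(\<And>y. \<bar>y - x\<bar> \<le> r \<Longrightarrow> h y \<le> c) \<Longrightarrow> upper_env r h x \<le> c"
    and "(\<And>y. \<bar>y - x\<bar> \<le> r \<Longrightarrow> c \<le> h y) \<Longrightarrow> c \<le> lower_env r h x"
proof -
  have *: "{y::real. \<bar>y\<bar> \<le> r} \<noteq> {}" using assms by (auto intro: exI[of _ 0])
  show "upper_env r h x \<le> c" if "\<And>y. \<bar>y - x\<bar> \<le> r \<Longrightarrow> h y \<le> c"
    unfolding upper_env_def by (rule cSUP_least[OF *]) (use that in simp)
  show "c \<le> lower_env r h x" if "\<And>y. \<bar>y - x\<bar> \<le> r \<Longrightarrow> c \<le> h y"
    unfolding lower_env_def by (rule cINF_greatest[OF *]) (use that in simp)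
qed

text \<open>
  The gap between the envelopes at \<open>x\<close> alone, rather than a uniform bound, controls the increment:
  this is what later makes the right-hand side small in mean.
\<close>

lemma moving_average_env_increment:
  assumes "h \<in> borel_measurable borel" "\<And>x. \<bar>h x\<bar> \<le> 1" "t > 0" "\<bar>x' - x\<bar> \<le> d"
  shows "\<bar>moving_average t h x - moving_average t h x'\<bar>
    \<le> d / (2 * t) * (upper_env (t + d) h x - lower_env (t + d) h x)"
proof -
  let ?l = "lower_env (t + d) h x" and ?u = "upper_env (t + d) h x"
  have b: "?l \<le> h y \<and> h y \<le> ?u" if "\<bar>y - x\<bar> \<le> t + d" for y
    using env_bounds[of h, OF assms(2) that] by simp
  have "?l \<le> ?u" using b[of x] assms(3,4) by simp
  have "\<bar>moving_average t h x - moving_average t h x'\<bar> \<le> \<bar>x' - x\<bar> / (2 * t) * (?u - ?l)"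
  proof (cases "x \<le> x'")
    case True
    thus ?thesis
      using moving_average_increment[OF assms(1-3) True, of ?l ?u] b assms(4) by force
  next
    case False
    hence "x' \<le> x" by simp
    thus ?thesis
      using moving_average_increment[OF assms(1-3) \<open>x' \<le> x\<close>, of ?l ?u] b assms(4)
      by (force simp: abs_minus_commute)
  qed
  also have "\<dots> \<le> d / (2 * t) * (?u - ?l)"
    using assms(3,4) \<open>?l \<le> ?u\<close> by (intro mult_right_mono divide_right_mono) auto
  finally show ?thesis .
qed

section \<open>Bounded solutions of Stein's equation\<close>

abbreviation gauss_lower :: "(real \<Rightarrow> real) \<Rightarrow> real \<Rightarrow> real" where
  "gauss_lower q w \<equiv> (LINT x:{..w}|lborel. std_normal_density x * q x)"

abbreviation gauss_upper :: "(real \<Rightarrow> real) \<Rightarrow> real \<Rightarrow> real" where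
  "gauss_upper q w \<equiv> (LINT x:{w..}|lborel. std_normal_density x * q x)"

interpretation std_normal: prob_space std_normal_distribution
  by (rule prob_space_normal_density) simp

lemma integrable_std_normal_density_mult:
  assumes "q \<in> borel_measurable borel" "\<And>x. \<bar>q x\<bar> \<le> C"
  shows "integrable lborel (\<lambda>x. std_normal_density x * q x)"
proof (rule Bochner_Integration.integrable_bound)
  show "integrable lborel (\<lambda>x. C * std_normal_density x)"
    using integrable_std_normal_moment[of 0] by simp
  have "0 \<le> C" using assms(2)[of 0] by linarith
  thus "AE x in lborel. norm (std_normal_density x * q x) \<le> norm (C * std_normal_density x)"
    using assms(2) by (intro AE_I2) (simp add: abs_mult mult.commute mult_right_mono)
qed (use assms(1) in simp)

lemma normal_expectation_lborel:
  assumes "q \<in> borel_measurable borel"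
  shows "normal_expectation q = (LINT x|lborel. std_normal_density x * q x)"
  unfolding normal_expectation_def using assms by (subst integral_density) auto

lemma set_integrable_gauss:
  assumes "q \<in> borel_measurable borel" "\<And>x. \<bar>q x\<bar> \<le> C" "S \<in> sets borel"
  shows "set_integrable lborel S (\<lambda>x. std_normal_density x * q x)"
  unfolding set_integrable_def
  by (rule integrable_mult_indicator[OF _ integrable_std_normal_density_mult[OF assms(1,2)]])
     (use assms(3) in simp)

lemma has_derivative_gauss_lower:
  assumes "continuous_on UNIV q" "\<And>x. \<bar>q x\<bar> \<le> C"
  shows "(gauss_lower q has_real_derivative std_normal_density w * q w) (at w)"
proof -
  let ?f = "\<lambda>x. std_normal_density x * q x"
  have meas: "q \<in> borel_measurable borel"
    using assms(1) by (rule borel_measurable_continuous_onI)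
  note si = set_integrable_gauss[OF meas assms(2)]
  have int: "?f integrable_on S" and eq: "(LINT x:S|lborel. ?f x) = integral S ?f"
    if "S \<in> sets borel" for S
    using set_borel_integral_eq_integral[OF si[OF that]] by auto
  \<comment> \<open>The base point w - 1 only serves to reduce to an integral over a compact interval.\<close>
  have "gauss_lower q v = gauss_lower q (w - 1) + integral {w - 1..v} ?f" if "v > w - 1" for v
  proof -
    have "{..v} = {..w - 1} \<union> {w - 1..v}" using that by auto
    moreover have "integral ({..w - 1} \<union> {w - 1..v}) ?f = integral {..w - 1} ?f + integral {w - 1..v} ?f"
    proof (rule integral_Un)
      have "{..w - 1} \<inter> {w - 1..v} \<subseteq> {w - 1}" by auto
      thus "negligible ({..w - 1} \<inter> {w - 1..v})"
        by (meson negligible_sing negligible_subset)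
    qed (simp_all add: int)
    ultimately show ?thesis by (simp add: eq)
  qed
  hence ev: "eventually (\<lambda>v. gauss_lower q v = gauss_lower q (w - 1) + integral {w - 1..v} ?f) (nhds w)"
    using eventually_nhds_in_open[of "{w - 1<..}" w] by (auto elim!: eventually_mono)
  have cont: "continuous_on {w - 1..w + 1} ?f"
    using assms(1) unfolding std_normal_density_def
    by (intro continuous_intros) (auto intro: continuous_on_subset)
  have "((\<lambda>v. integral {w - 1..v} ?f) has_real_derivative ?f w) (at w within {w - 1..w + 1})"
    by (rule integral_has_real_derivative[OF cont]) simp
  hence "((\<lambda>v. integral {w - 1..v} ?f) has_real_derivative ?f w) (at w)"
    using at_within_interior[of w "{w - 1..w + 1}"] by simp
  hence "((\<lambda>v. gauss_lower q (w - 1) + integral {w - 1..v} ?f) has_real_derivative ?f w) (at w)"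
    using DERIV_add[OF DERIV_const] by fastforce
  thus ?thesis
    using DERIV_cong_ev[OF refl ev refl] by simp
qed

lemma gauss_lower_plus_upper:
  assumes "q \<in> borel_measurable borel" "\<And>x. \<bar>q x\<bar> \<le> C"
  shows "gauss_lower q w + gauss_upper q w = normal_expectation q"
proof -
  let ?f = "\<lambda>x. std_normal_density x * q x"
  note si = set_integrable_gauss[OF assms]
  have int: "?f integrable_on S" and eq: "(LINT x:S|lborel. ?f x) = integral S ?f"
    if "S \<in> sets borel" for S
    using set_borel_integral_eq_integral[OF si[OF that]] by auto
  have "{..w} \<union> {w..} = UNIV" "{..w} \<inter> {w..} = {w}" by auto
  hence "integral UNIV ?f = integral {..w} ?f + integral {w..} ?f"
    using integral_Un[of ?f "{..w}" "{w..}"] int by simp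
  moreover have "(LINT x:UNIV|lborel. ?f x) = normal_expectation q"
    using normal_expectation_lborel[OF assms(1)] by (simp add: set_lebesgue_integral_def)
  ultimately show ?thesis by (simp add: eq)
qed

lemma gauss_lower_reflect: "gauss_lower q w = gauss_upper (\<lambda>x. q (- x)) (- w)"
proof -
  have "{x::real. - x \<le> w} = {- w..}" by auto
  thus ?thesis
    by (subst set_integral_reflect) (simp add: std_normal_density_def)
qed

lemma std_normal_density_has_derivative:
  "(std_normal_density has_real_derivative - x * std_normal_density x) (at x)"
  unfolding std_normal_density_def[abs_def]
  by (rule derivative_eq_intros refl | simp)+

lemma std_normal_density_at_top: "(std_normal_density \<longlongrightarrow> 0) at_top"
  unfolding std_normal_density_def[abs_def] by real_asymp

text \<open>
  The function \<open>x \<phi>(x)\<close> has the explicit primitive \<open>- \<phi>(x)\<close>; Mills' inequality for the tail of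
  \<open>\<phi>\<close> follows by inserting a factor \<open>x / w \<ge> 1\<close>.
\<close>

lemma gauss_tail_first_moment:
  assumes "w \<ge> 0"
  shows "has_bochner_integral lborel (\<lambda>x. indicator {w..} x * (x * std_normal_density x)) (std_normal_density w)"
proof (rule has_bochner_integral_nn_integral)
  have "(\<integral>\<^sup>+x. ennreal (x * std_normal_density x) * indicator {w ..} x \<partial>lborel) = 0 - (- std_normal_density w)"
  proof (rule nn_integral_FTC_atLeast)
    show "((\<lambda>x. - std_normal_density x) \<longlongrightarrow> 0) at_top"
      using tendsto_minus[OF std_normal_density_at_top] by simp
    show "((\<lambda>x. - std_normal_density x) has_real_derivative x * std_normal_density x) (at x)" for x
      using DERIV_minus[OF std_normal_density_has_derivative[of x]] by simp
  qed (use assms in auto)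
  moreover have "ennreal (indicator {w..} x * (x * std_normal_density x)) = ennreal (x * std_normal_density x) * indicator {w ..} x" for x
    by (auto split: split_indicator)
  ultimately show "(\<integral>\<^sup>+x. ennreal (indicator {w..} x * (x * std_normal_density x)) \<partial>lborel) = ennreal (std_normal_density w)"
    by simp
qed (use assms in \<open>auto split: split_indicator\<close>)

lemma mills_ratio_upper:
  assumes "q \<in> borel_measurable borel" "\<And>x. \<bar>q x\<bar> \<le> C" "w \<ge> 0"
  shows "w * \<bar>gauss_upper q w\<bar> \<le> C * std_normal_density w"
proof -
  note tail = gauss_tail_first_moment[OF assms(3)]
  have int: "integrable lborel (\<lambda>x. indicator {w..} x * (std_normal_density x * q x))"
    using set_integrable_gauss[OF assms(1,2), of "{w..}"] by (simp add: set_integrable_def)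
  have C: "0 \<le> C" using assms(2)[of 0] by linarith
  have "w * \<bar>gauss_upper q w\<bar> \<le> w * (LINT x|lborel. \<bar>indicator {w..} x * (std_normal_density x * q x)\<bar>)"
    using assms(3) integral_abs_bound[of lborel "\<lambda>x. indicator {w..} x * (std_normal_density x * q x)"]
    by (intro mult_left_mono) (auto simp: set_lebesgue_integral_def)
  also have "\<dots> = (LINT x|lborel. w * \<bar>indicator {w..} x * (std_normal_density x * q x)\<bar>)" by simp
  also have "\<dots> \<le> (LINT x|lborel. C * (indicator {w..} x * (x * std_normal_density x)))"
  proof (rule integral_mono)
    show "integrable lborel (\<lambda>x. C * (indicator {w..} x * (x * std_normal_density x)))"
      using tail by (auto simp: has_bochner_integral_iff)
    show "w * \<bar>indicator {w..} x * (std_normal_density x * q x)\<bar> \<le> C * (indicator {w..} x * (x * std_normal_density x))" for x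
    proof (cases "w \<le> x")
      case True
      have "w * \<bar>q x\<bar> \<le> x * C" using True assms(2)[of x] assms(3) by (intro mult_mono) auto
      hence "(w * \<bar>q x\<bar>) * std_normal_density x \<le> (x * C) * std_normal_density x"
        by (rule mult_right_mono) simp
      thus ?thesis using True by (simp add: abs_mult mult_ac)
    qed simp
  qed (use int in auto)
  also have "\<dots> = C * std_normal_density w"
    using tail by (simp add: has_bochner_integral_iff)
  finally show ?thesis .
qed

text \<open>
  Each of the two tails of \<open>\<phi> q\<close> is controlled by Mills' inequality on its own side of the origin
  only. Since the total integral vanishes, the lower tail is minus the upper tail, so one may always
  use the one that is small.
\<close>

lemma centred_gauss_lower_bound:
  assumes "q \<in> borel_measurable borel" "\<And>x. \<bar>q x\<bar> \<le> C" "normal_expectation q = 0"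
  shows "\<bar>w * gauss_lower q w\<bar> \<le> C * std_normal_density w" "\<bar>gauss_lower q w\<bar> \<le> C"
proof -
  show "\<bar>w * gauss_lower q w\<bar> \<le> C * std_normal_density w"
  proof (cases "w \<ge> 0")
    case True
    have "gauss_lower q w = - gauss_upper q w"
      using gauss_lower_plus_upper[OF assms(1,2), of w] assms(3) by simp
    thus ?thesis using mills_ratio_upper[OF assms(1,2) True] True by (simp add: abs_mult)
  next
    case False
    have sym: "std_normal_density (- w) = std_normal_density w" by (simp add: std_normal_density_def)
    have "(- w) * \<bar>gauss_upper (\<lambda>x. q (- x)) (- w)\<bar> \<le> C * std_normal_density (- w)"
      by (rule mills_ratio_upper) (use False assms in auto)
    thus ?thesis using False
      by (simp only: gauss_lower_reflect[of w q] sym) (simp add: abs_mult)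
  qed
  let ?g = "\<lambda>x. indicator {..w} x * (std_normal_density x * q x)"
  have C: "0 \<le> C" using assms(2)[of 0] by linarith
  have "\<bar>gauss_lower q w\<bar> \<le> (LINT x|lborel. \<bar>?g x\<bar>)"
    using integral_abs_bound[of lborel ?g] by (simp add: set_lebesgue_integral_def)
  also have "\<dots> \<le> (LINT x|lborel. C * std_normal_density x)"
  proof (rule integral_mono)
    show "integrable lborel (\<lambda>x. \<bar>?g x\<bar>)"
      using set_integrable_gauss[OF assms(1,2), of "{..w}"] by (simp add: set_integrable_def)
    show "integrable lborel (\<lambda>x. C * std_normal_density x)"
      using integrable_std_normal_moment[of 0] by simp
    show "\<bar>?g x\<bar> \<le> C * std_normal_density x" for x
      using assms(2)[of x] C by (auto simp: abs_mult mult.commute intro!: mult_right_mono split: split_indicator)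
  qed
  also have "\<dots> = C" using integral_std_normal_moment_even[of 0] by simp
  finally show "\<bar>gauss_lower q w\<bar> \<le> C" .
qed

lemma inverse_std_normal_density_le:
  assumes "\<bar>w\<bar> \<le> 1"
  shows "1 / std_normal_density w \<le> 5"
proof -
  have "w\<^sup>2 \<le> 1" using assms by (simp add: abs_square_le_1)
  hence "exp (w\<^sup>2) \<le> exp 1" by simp
  also have "\<dots> \<le> (3::real)" by (rule exp_le)
  finally have "exp (w\<^sup>2) \<le> 3" .
  moreover have "2 * pi \<le> 8" using pi_less_4 by simp
  ultimately have "(2 * pi) * exp (w\<^sup>2) \<le> 8 * 3" by (intro mult_mono) auto
  hence "(2 * pi) * exp (w\<^sup>2) \<le> 5\<^sup>2" by simp
  moreover have "(sqrt (2 * pi) * exp (w\<^sup>2 / 2))\<^sup>2 = (2 * pi) * exp (w\<^sup>2)"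
    by (simp add: power_mult_distrib flip: exp_double)
  ultimately have "sqrt (2 * pi) * exp (w\<^sup>2 / 2) \<le> 5"
    by (metis power2_le_imp_le zero_le_numeral)
  thus ?thesis by (simp add: std_normal_density_def exp_minus field_simps)
qed

text \<open>
  With \<open>q = g - N g\<close> the solution is \<open>f(w) = (\<integral> \<phi> q over (-\<infinity>, w]) / \<phi>(w)\<close>. Away from \<open>[-1, 1]\<close> the bound on
  \<open>w f(w)\<close> also bounds \<open>f\<close>; on \<open>[-1, 1]\<close> the density is at least \<open>1/5\<close>.
\<close>

lemma stein_solution:
  assumes "continuous_on UNIV g" "\<And>x. \<bar>g x\<bar> \<le> 1"
  obtains f where
    "\<And>w. (f has_real_derivative w * f w + (g w - normal_expectation g)) (at w)"
    "\<And>w. \<bar>f w\<bar> \<le> 10" "\<And>w. \<bar>w * f w\<bar> \<le> 2" "\<bar>normal_expectation g\<bar> \<le> 1"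
proof -
  define c where "c = normal_expectation g"
  define q where "q x = g x - c" for x
  have meas: "g \<in> borel_measurable borel"
    using assms(1) by (rule borel_measurable_continuous_onI)
  have intg: "integrable std_normal_distribution g"
    by (rule std_normal.integrable_const_bound[where B = 1]) (use assms(2) meas in auto)
  have c: "\<bar>c\<bar> \<le> 1"
  proof -
    have "\<bar>c\<bar> \<le> std_normal.expectation (\<lambda>x. \<bar>g x\<bar>)"
      unfolding c_def normal_expectation_def by (rule integral_abs_bound)
    also have "\<dots> \<le> std_normal.expectation (\<lambda>_. 1)"
      by (rule integral_mono) (use intg assms(2) in auto)
    also have "\<dots> = 1" using std_normal.prob_space by simp
    finally show ?thesis .
  qed
  have q_cont: "continuous_on UNIV q" unfolding q_def using assms(1) by (intro continuous_intros)
  have q_meas: "q \<in> borel_measurable borel" unfolding q_def[abs_def] using meas by simp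
  have q_le: "\<bar>q x\<bar> \<le> 2" for x using assms(2)[of x] c by (simp add: q_def)
  have q0: "normal_expectation q = 0"
    using intg unfolding q_def[abs_def] c_def normal_expectation_def
    using std_normal.prob_space by (subst Bochner_Integration.integral_diff) auto
  define f where "f w = gauss_lower q w / std_normal_density w" for w
  have pos: "std_normal_density w > 0" for w by (rule normal_density_pos) simp
  note b = centred_gauss_lower_bound[OF q_meas q_le q0]
  have f2: "\<bar>w * f w\<bar> \<le> 2" for w
    using b(1)[of w] pos[of w] by (simp add: f_def abs_mult field_simps)
  have f10: "\<bar>f w\<bar> \<le> 10" for w
  proof (cases "\<bar>w\<bar> \<le> 1")
    case True
    have "\<bar>f w\<bar> = \<bar>gauss_lower q w\<bar> * (1 / std_normal_density w)" using pos[of w] by (simp add: f_def)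
    also have "\<dots> \<le> 2 * 5"
      using b(2) inverse_std_normal_density_le[OF True] pos[of w] by (intro mult_mono) auto
    finally show ?thesis by simp
  next
    case False
    hence "1 * \<bar>f w\<bar> \<le> \<bar>w\<bar> * \<bar>f w\<bar>" by (intro mult_right_mono) auto
    thus ?thesis using f2[of w] by (simp add: abs_mult)
  qed
  have "(f has_real_derivative w * f w + (g w - normal_expectation g)) (at w)" for w
  proof -
    have "std_normal_density w \<noteq> 0" using pos[of w] by simp
    from DERIV_divide[OF has_derivative_gauss_lower[OF q_cont q_le] std_normal_density_has_derivative this]
    show ?thesis unfolding f_def[abs_def]
      by (rule DERIV_cong) (use pos[of w] in \<open>simp add: q_def c_def field_simps power2_eq_square\<close>)
  qed
  with f10 f2 c that[of f] show ?thesis unfolding c_def by blast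
qed

section \<open>The zero bias identity and Stein's method\<close>

lemma lipschitz_imp_absolutely_continuous_fun:
  assumes "\<And>x y. \<bar>f x - f y\<bar> \<le> L * \<bar>x - y\<bar>"
  shows "absolutely_continuous_fun f"
  unfolding absolutely_continuous_fun_def absolutely_continuous_fun_on_def
proof (intro allI impI)
  fix a b \<epsilon> :: real assume "\<epsilon> > 0"
  have L: "L \<ge> 0" using assms[of 0 1] by simp
  show "\<exists>\<eta>>0. \<forall>(n::nat) u v.
        (\<forall>i<n. a \<le> u i \<and> u i \<le> v i \<and> v i \<le> b) \<and>
        (\<forall>i<n. \<forall>j<n. i \<noteq> j \<longrightarrow> {u i<..<v i} \<inter> {u j<..<v j} = {}) \<and>
        (\<Sum>i<n. v i - u i) < \<eta> \<longrightarrow>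
        (\<Sum>i<n. \<bar>f (v i) - f (u i)\<bar>) < \<epsilon>"
  proof (intro exI[of _ "\<epsilon> / (L + 1)"] conjI allI impI)
    show "\<epsilon> / (L + 1) > 0" using \<open>\<epsilon> > 0\<close> L by simp
  next
    fix n :: nat and u v :: "nat \<Rightarrow> real"
    assume *: "(\<forall>i<n. a \<le> u i \<and> u i \<le> v i \<and> v i \<le> b) \<and>
        (\<forall>i<n. \<forall>j<n. i \<noteq> j \<longrightarrow> {u i<..<v i} \<inter> {u j<..<v j} = {}) \<and>
        (\<Sum>i<n. v i - u i) < \<epsilon> / (L + 1)"
    have nonneg: "0 \<le> (\<Sum>i<n. v i - u i)" using * by (intro sum_nonneg) auto
    have "(\<Sum>i<n. \<bar>f (v i) - f (u i)\<bar>) \<le> (\<Sum>i<n. L * (v i - u i))"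
    proof (rule sum_mono)
      fix i assume "i \<in> {..<n}"
      thus "\<bar>f (v i) - f (u i)\<bar> \<le> L * (v i - u i)" using assms[of "v i" "u i"] * by simp
    qed
    also have "\<dots> = L * (\<Sum>i<n. v i - u i)" by (simp add: sum_distrib_left)
    also have "\<dots> \<le> (L + 1) * (\<Sum>i<n. v i - u i)" using nonneg by (intro mult_right_mono) auto
    also have "\<dots> < \<epsilon>" using * L by (simp add: field_simps)
    finally show "(\<Sum>i<n. \<bar>f (v i) - f (u i)\<bar>) < \<epsilon>" .
  qed
qed

lemma bounded_derivative_imp_lipschitz:
  fixes f :: "real \<Rightarrow> real"
  assumes "\<And>x. (f has_real_derivative f' x) (at x)" "\<And>x. \<bar>f' x\<bar> \<le> L"
  shows "\<bar>f x - f y\<bar> \<le> L * \<bar>x - y\<bar>"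
proof -
  have "norm (f x - f y) \<le> L * norm (x - y)"
    by (rule field_differentiable_bound[of UNIV f f']) (use assms in auto)
  thus ?thesis by simp
qed

text \<open>
  A bounded derivative makes \<open>f\<close> Lipschitz, hence absolutely continuous, and the bounds on \<open>f\<close> and
  \<open>f'\<close> make both sides of the zero bias identity exist.
\<close>

lemma zero_biased_bounded_C1:
  assumes "prob_space M" "Y \<in> borel_measurable M" "integrable M Y" "zero_biased M Y Ys"
    and "\<And>x. (f has_real_derivative f' x) (at x)" "continuous_on UNIV f'"
    and "\<And>x. \<bar>f' x\<bar> \<le> L" "\<And>x. \<bar>f x\<bar> \<le> K"
  shows "prob_space.expectation M (\<lambda>\<omega>. Y \<omega> * f (Y \<omega>))
    = prob_space.variance M Y * prob_space.expectation M (\<lambda>\<omega>. f' (Ys \<omega>))"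
proof -
  interpret prob_space M by fact
  have Ys[measurable]: "Ys \<in> borel_measurable M" using assms(4) by (simp add: zero_biased_def)
  note Y[measurable] = assms(2)
  have d: "deriv f = f'" using assms(5) by (auto intro: DERIV_imp_deriv)
  have "continuous_on UNIV f" using assms(5) by (rule DERIV_continuous_on[OF has_field_derivative_at_within])
  hence f[measurable]: "f \<in> borel_measurable borel" by (rule borel_measurable_continuous_onI)
  have f'[measurable]: "f' \<in> borel_measurable borel" using assms(6) by (rule borel_measurable_continuous_onI)
  have "K \<ge> 0" using assms(8)[of 0] by linarith
  have "absolutely_continuous_fun f"
    by (rule lipschitz_imp_absolutely_continuous_fun[OF bounded_derivative_imp_lipschitz[OF assms(5,7)]])
  moreover have "integrable M (\<lambda>\<omega>. Y \<omega> * f (Y \<omega>))"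
  proof (rule Bochner_Integration.integrable_bound)
    show "integrable M (\<lambda>\<omega>. K * Y \<omega>)" using assms(3) by simp
    have "\<bar>Y \<omega>\<bar> * \<bar>f (Y \<omega>)\<bar> \<le> \<bar>Y \<omega>\<bar> * K" for \<omega>
      by (rule mult_left_mono) (use assms(8) in auto)
    thus "AE \<omega> in M. norm (Y \<omega> * f (Y \<omega>)) \<le> norm (K * Y \<omega>)"
      using \<open>K \<ge> 0\<close> by (intro AE_I2) (simp add: abs_mult mult.commute)
  qed simp
  moreover have "integrable M (\<lambda>\<omega>. deriv f (Ys \<omega>))"
    unfolding d by (rule integrable_const_bound[where B = L]) (use assms(7) in auto)
  ultimately have "expectation (\<lambda>\<omega>. Y \<omega> * f (Y \<omega>)) = variance Y * expectation (\<lambda>\<omega>. deriv f (Ys \<omega>))"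
    using conjunct2[OF assms(4)[unfolded zero_biased_def], THEN spec[where x = f]] by simp
  thus ?thesis unfolding d .
qed

lemma zero_biased_rescaled:
  assumes "prob_space M" "Y \<in> borel_measurable M" "integrable M Y" "zero_biased M Y Ys"
    and "\<sigma> > 0" "prob_space.variance M Y = \<sigma>\<^sup>2"
    and "\<And>x. (f has_real_derivative f' x) (at x)" "continuous_on UNIV f'"
    and "\<And>x. \<bar>f' x\<bar> \<le> L" "\<And>x. \<bar>f x\<bar> \<le> K"
  shows "prob_space.expectation M (\<lambda>\<omega>. Y \<omega> / \<sigma> * f (Y \<omega> / \<sigma>))
    = prob_space.expectation M (\<lambda>\<omega>. f' (Ys \<omega> / \<sigma>))"
proof -
  interpret prob_space M by fact
  have "expectation (\<lambda>\<omega>. Y \<omega> * f (Y \<omega> / \<sigma>)) = variance Y * expectation (\<lambda>\<omega>. f' (Ys \<omega> / \<sigma>) * (1 / \<sigma>))"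
  proof (rule zero_biased_bounded_C1[OF assms(1-4),
        of "\<lambda>y. f (y / \<sigma>)" "\<lambda>y. f' (y / \<sigma>) * (1 / \<sigma>)" "L * (1 / \<sigma>)" K])
    show "((\<lambda>y. f (y / \<sigma>)) has_real_derivative f' (x / \<sigma>) * (1 / \<sigma>)) (at x)" for x
    proof -
      have "((\<lambda>y. y / \<sigma>) has_real_derivative 1 / \<sigma>) (at x)"
        by (rule DERIV_cdivide[OF DERIV_ident])
      from DERIV_chain'[OF this assms(7)] show ?thesis .
    qed
    show "continuous_on UNIV (\<lambda>y. f' (y / \<sigma>) * (1 / \<sigma>))"
    proof (rule continuous_on_mult[OF _ continuous_on_const], rule continuous_on_compose2[OF assms(8)])
      show "continuous_on UNIV (\<lambda>y. y / \<sigma>)" using \<open>\<sigma> > 0\<close> by (intro continuous_intros) auto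
    qed simp
    show "\<bar>f' (x / \<sigma>) * (1 / \<sigma>)\<bar> \<le> L * (1 / \<sigma>)" for x
      using assms(9)[of "x / \<sigma>"] \<open>\<sigma> > 0\<close> by (simp add: divide_right_mono)
    show "\<bar>f (x / \<sigma>)\<bar> \<le> K" for x by (rule assms(10))
  qed
  thus ?thesis using assms(5,6) by (simp add: power2_eq_square)
qed

text \<open>
  The constant \<open>14\<close> arises from
  \<open>W f(W) - V f(V) = W (f(W) - f(V)) + (W - V) f(V)\<close> with \<open>\<bar>f'\<bar> \<le> 4\<close>, \<open>\<bar>f\<bar> \<le> 10\<close> and
  \<open>E \<bar>W\<bar> \<le> 1\<close>. The last inequality enters in the form \<open>\<bar>w\<bar> \<le> (1 + w\<^sup>2) / 2\<close>.
\<close>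

lemma zero_bias_stein_bound:
  assumes "prob_space M" and [measurable]: "W \<in> borel_measurable M" "V \<in> borel_measurable M"
    and W2: "integrable M (\<lambda>\<omega>. (W \<omega>)\<^sup>2)" "prob_space.expectation M (\<lambda>\<omega>. (W \<omega>)\<^sup>2) = 1"
    and zb: "\<And>f f' L K. \<lbrakk>\<And>x. (f has_real_derivative f' x) (at x); continuous_on UNIV f';
        \<And>x. \<bar>f' x\<bar> \<le> L; \<And>x. \<bar>f x\<bar> \<le> K\<rbrakk> \<Longrightarrow>
        prob_space.expectation M (\<lambda>\<omega>. W \<omega> * f (W \<omega>)) = prob_space.expectation M (\<lambda>\<omega>. f' (V \<omega>))"
    and close: "AE \<omega> in M. \<bar>V \<omega> - W \<omega>\<bar> \<le> A"
    and g: "continuous_on UNIV g" "\<And>x. \<bar>g x\<bar> \<le> 1"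
  shows "\<bar>prob_space.expectation M (\<lambda>\<omega>. g (W \<omega>)) - normal_expectation g\<bar>
    \<le> 14 * A + prob_space.expectation M (\<lambda>\<omega>. \<bar>g (W \<omega>) - g (V \<omega>)\<bar>)"
proof -
  interpret prob_space M by fact
  obtain f where f: "\<And>w. (f has_real_derivative w * f w + (g w - normal_expectation g)) (at w)"
    and f10: "\<And>w. \<bar>f w\<bar> \<le> 10" and wf: "\<And>w. \<bar>w * f w\<bar> \<le> 2" and c1: "\<bar>normal_expectation g\<bar> \<le> 1"
    using stein_solution[OF g] by blast
  define c where "c = normal_expectation g"
  define f' where "f' w = w * f w + (g w - c)" for w
  have df: "(f has_real_derivative f' w) (at w)" for w using f[of w] by (simp add: f'_def c_def)
  have f'4: "\<bar>f' w\<bar> \<le> 4" for w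
    using wf[of w] c1 g(2)[of w] unfolding f'_def c_def by linarith
  note lip = bounded_derivative_imp_lipschitz[OF df f'4]
  have f_cont: "continuous_on UNIV f" using df by (rule DERIV_continuous_on[OF has_field_derivative_at_within])
  have f'_cont: "continuous_on UNIV f'" unfolding f'_def using f_cont g(1) by (intro continuous_intros)
  have [measurable]: "f \<in> borel_measurable borel" "f' \<in> borel_measurable borel" "g \<in> borel_measurable borel"
    using f_cont f'_cont g(1) by (auto intro: borel_measurable_continuous_onI)
  have int: "integrable M (\<lambda>\<omega>. g (W \<omega>))" "integrable M (\<lambda>\<omega>. g (V \<omega>))"
    "integrable M (\<lambda>\<omega>. f' (W \<omega>))" "integrable M (\<lambda>\<omega>. f' (V \<omega>))" "integrable M (\<lambda>\<omega>. W \<omega> * f (W \<omega>))"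
    using g(2) f'4 wf
    by (auto intro: integrable_const_bound[where B = 1] integrable_const_bound[where B = 4]
        integrable_const_bound[where B = 2])
  have "expectation (\<lambda>\<omega>. f' (V \<omega>)) = expectation (\<lambda>\<omega>. W \<omega> * f (W \<omega>))"
    by (rule zb[OF df f'_cont f'4 f10, symmetric])
  also have "\<dots> = expectation (\<lambda>\<omega>. f' (W \<omega>) - (g (W \<omega>) - c))" by (simp add: f'_def)
  also have "\<dots> = expectation (\<lambda>\<omega>. f' (W \<omega>)) - (expectation (\<lambda>\<omega>. g (W \<omega>)) - c)"
    using int by (simp add: prob_space)
  finally have "expectation (\<lambda>\<omega>. g (W \<omega>)) - c = expectation (\<lambda>\<omega>. f' (W \<omega>) - f' (V \<omega>))"
    using int by simp
  also have "\<bar>\<dots>\<bar> \<le> expectation (\<lambda>\<omega>. \<bar>f' (W \<omega>) - f' (V \<omega>)\<bar>)" by (rule integral_abs_bound)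
  also have "\<dots> \<le> expectation (\<lambda>\<omega>. 12 * A + 2 * A * (W \<omega>)\<^sup>2 + \<bar>g (W \<omega>) - g (V \<omega>)\<bar>)"
  proof (rule integral_mono_AE)
    show "AE \<omega> in M. \<bar>f' (W \<omega>) - f' (V \<omega>)\<bar> \<le> 12 * A + 2 * A * (W \<omega>)\<^sup>2 + \<bar>g (W \<omega>) - g (V \<omega>)\<bar>"
      using close
    proof eventually_elim
      case (elim \<omega>)
      define w v where "w = W \<omega>" and "v = V \<omega>"
      have wv: "\<bar>w - v\<bar> \<le> A" using elim by (simp add: w_def v_def abs_minus_commute)
      have "0 \<le> (\<bar>w\<bar> - 1)\<^sup>2" by simp
      hence "\<bar>w\<bar> \<le> (1 + w\<^sup>2) / 2" by (simp add: power2_diff)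
      moreover have "\<bar>f w - f v\<bar> \<le> 4 * A" using lip[of w v] mult_left_mono[OF wv, of 4] by simp
      ultimately have "\<bar>w\<bar> * \<bar>f w - f v\<bar> \<le> (1 + w\<^sup>2) / 2 * (4 * A)" by (intro mult_mono) auto
      moreover have "\<bar>w - v\<bar> * \<bar>f v\<bar> \<le> A * 10" using wv f10[of v] by (intro mult_mono) auto
      moreover have "f' w - f' v = w * (f w - f v) + (w - v) * f v + (g w - g v)"
        by (simp add: f'_def algebra_simps)
      moreover have "\<bar>w * (f w - f v) + (w - v) * f v + (g w - g v)\<bar>
          \<le> \<bar>w\<bar> * \<bar>f w - f v\<bar> + \<bar>w - v\<bar> * \<bar>f v\<bar> + \<bar>g w - g v\<bar>"
        using abs_mult[of w "f w - f v"] abs_mult[of "w - v" "f v"] by linarith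
      moreover have "(1 + w\<^sup>2) / 2 * (4 * A) = 2 * A + 2 * A * w\<^sup>2" by (simp add: field_simps)
      ultimately have "\<bar>f' w - f' v\<bar> \<le> 12 * A + 2 * A * w\<^sup>2 + \<bar>g w - g v\<bar>" by linarith
      thus ?case unfolding w_def v_def .
    qed
  qed (use int W2 in auto)
  also have "\<dots> = 14 * A + expectation (\<lambda>\<omega>. \<bar>g (W \<omega>) - g (V \<omega>)\<bar>)"
    using int W2 by (simp add: prob_space)
  finally show ?thesis by (simp add: c_def)
qed

section \<open>Smoothing within a test class\<close>

lemma expectation_bounded:
  fixes X :: "'a \<Rightarrow> real"
  assumes "prob_space M" "X \<in> borel_measurable M" "\<And>\<omega>. \<bar>X \<omega>\<bar> \<le> C"
  shows "integrable M X" "\<bar>prob_space.expectation M X\<bar> \<le> C"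
proof -
  interpret prob_space M by fact
  show i: "integrable M X" by (rule integrable_const_bound[where B = C]) (use assms in auto)
  have "\<bar>expectation X\<bar> \<le> expectation (\<lambda>\<omega>. \<bar>X \<omega>\<bar>)" by (rule integral_abs_bound)
  also have "\<dots> \<le> expectation (\<lambda>_. C)" by (rule integral_mono) (use i assms(3) in auto)
  also have "\<dots> = C" using prob_space by simp
  finally show "\<bar>expectation X\<bar> \<le> C" .
qed

lemma normal_expectation_bounded:
  assumes "h \<in> borel_measurable borel" "\<And>x. \<bar>h x\<bar> \<le> C"
  shows "integrable std_normal_distribution h" "\<bar>normal_expectation h\<bar> \<le> C"
  unfolding normal_expectation_def
  by (rule expectation_bounded[OF std_normal.prob_space_axioms, of h C], use assms in simp_all)+

lemma test_classD:
  assumes "test_class H a" "h \<in> H"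
  shows "h \<in> borel_measurable borel" "\<bar>h x\<bar> \<le> 1"
    and "\<epsilon> > 0 \<Longrightarrow> upper_env \<epsilon> h \<in> H" "\<epsilon> > 0 \<Longrightarrow> lower_env \<epsilon> h \<in> H"
    and "\<epsilon> > 0 \<Longrightarrow> normal_expectation (\<lambda>x. upper_env \<epsilon> h x - lower_env \<epsilon> h x) \<le> a * \<epsilon>"
proof -
  from assms have "h \<in> borel_measurable borel \<and> (\<forall>x. \<bar>h x\<bar> \<le> 1)"
    and *: "\<forall>\<epsilon>>0. upper_env \<epsilon> h \<in> H \<and> lower_env \<epsilon> h \<in> H \<and>
        normal_expectation (\<lambda>x. upper_env \<epsilon> h x - lower_env \<epsilon> h x) \<le> a * \<epsilon>"
    unfolding test_class_def by blast+
  thus "h \<in> borel_measurable borel" "\<bar>h x\<bar> \<le> 1" by simp_all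
  show "\<epsilon> > 0 \<Longrightarrow> upper_env \<epsilon> h \<in> H" "\<epsilon> > 0 \<Longrightarrow> lower_env \<epsilon> h \<in> H"
    "\<epsilon> > 0 \<Longrightarrow> normal_expectation (\<lambda>x. upper_env \<epsilon> h x - lower_env \<epsilon> h x) \<le> a * \<epsilon>"
    using * by simp_all
qed

lemma test_class_constant_nonneg:
  assumes "test_class H a"
  shows "a \<ge> 0"
proof -
  obtain h where h: "h \<in> H" using assms by (auto simp: test_class_def)
  note h1 = test_classD(2)[OF assms h]
  have "0 \<le> upper_env 1 h x - lower_env 1 h x" for x
    using env_bounds[of h x x 1] h1 by simp
  hence "0 \<le> normal_expectation (\<lambda>x. upper_env 1 h x - lower_env 1 h x)"
    unfolding normal_expectation_def by (intro integral_nonneg_AE) auto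
  also have "\<dots> \<le> a" using test_classD(5)[OF assms h, of 1] by simp
  finally show ?thesis .
qed

lemma test_class_deviation_le_normal_distance:
  assumes "prob_space M" and W[measurable]: "W \<in> borel_measurable M" and "test_class H a" "h \<in> H"
  shows "\<bar>prob_space.expectation M (\<lambda>\<omega>. h (W \<omega>)) - normal_expectation h\<bar> \<le> normal_distance M W H"
  unfolding normal_distance_def
proof (rule cSUP_upper[OF \<open>h \<in> H\<close>], rule bdd_aboveI2[where M = 2])
  fix k assume "k \<in> H"
  note [measurable] = test_classD(1)[OF assms(3) this] and k1 = test_classD(2)[OF assms(3) this]
  have "\<bar>prob_space.expectation M (\<lambda>\<omega>. k (W \<omega>))\<bar> \<le> 1"
    by (rule expectation_bounded(2)[OF assms(1)]) (use k1 in auto)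
  moreover have "\<bar>normal_expectation k\<bar> \<le> 1"
    by (rule normal_expectation_bounded) (use k1 in auto)
  ultimately show "\<bar>prob_space.expectation M (\<lambda>\<omega>. k (W \<omega>)) - normal_expectation k\<bar> \<le> 2" by linarith
qed

text \<open>
  Under the normal law the mean gap is at most \<open>a r\<close>; both envelopes belong to the class, so passing
  to the law of \<open>W\<close> changes each mean by at most the normal distance.
\<close>

lemma test_class_envelope_gap:
  assumes "prob_space M" and W[measurable]: "W \<in> borel_measurable M"
    and H: "test_class H a" "h \<in> H" and "r > 0"
  shows "prob_space.expectation M (\<lambda>\<omega>. upper_env r h (W \<omega>) - lower_env r h (W \<omega>))
    \<le> a * r + 2 * normal_distance M W H"
proof -
  interpret prob_space M by fact
  let ?u = "upper_env r h" and ?l = "lower_env r h"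
  have u: "?u \<in> H" and l: "?l \<in> H" using test_classD(3,4)[OF H \<open>r > 0\<close>] .
  note [measurable] = test_classD(1)[OF H(1) u] test_classD(1)[OF H(1) l]
  have int: "integrable M (\<lambda>\<omega>. ?u (W \<omega>))" "integrable M (\<lambda>\<omega>. ?l (W \<omega>))"
    by (rule expectation_bounded(1)[OF assms(1), where C = 1];
        use test_classD(2)[OF H(1) u] test_classD(2)[OF H(1) l] in simp)+
  have nint: "integrable std_normal_distribution ?u" "integrable std_normal_distribution ?l"
    by (rule normal_expectation_bounded(1)[where C = 1];
        use test_classD(2)[OF H(1) u] test_classD(2)[OF H(1) l] in simp)+
  have "normal_expectation (\<lambda>x. ?u x - ?l x) = normal_expectation ?u - normal_expectation ?l"
    unfolding normal_expectation_def using nint by simp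
  moreover have "normal_expectation (\<lambda>x. ?u x - ?l x) \<le> a * r" by (rule test_classD(5)[OF H \<open>r > 0\<close>])
  moreover note test_class_deviation_le_normal_distance[OF assms(1,2) H(1) u]
    test_class_deviation_le_normal_distance[OF assms(1,2) H(1) l]
  moreover have "expectation (\<lambda>\<omega>. ?u (W \<omega>) - ?l (W \<omega>)) = expectation (\<lambda>\<omega>. ?u (W \<omega>)) - expectation (\<lambda>\<omega>. ?l (W \<omega>))"
    using int by simp
  ultimately show ?thesis by linarith
qed

lemma moving_average_bounded_borel:
  assumes "h \<in> borel_measurable borel" "\<And>x. \<bar>h x\<bar> \<le> 1" "t > 0"
  shows "moving_average t h \<in> borel_measurable borel" "\<bar>moving_average t h x\<bar> \<le> 1"
proof -
  show "moving_average t h \<in> borel_measurable borel"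
    using continuous_moving_average[OF assms] by (rule borel_measurable_continuous_onI)
  have "- 1 \<le> h y \<and> h y \<le> 1" for y using assms(2)[of y] by linarith
  thus "\<bar>moving_average t h x\<bar> \<le> 1"
    using moving_average_between[OF assms, of x "-1" 1] by (simp add: abs_le_iff)
qed

text \<open>
  Because the averaging window is compact, \<open>h\<close> lies between the averages of its lower and upper
  envelopes of radius \<open>t\<close>, which in turn lie between its own envelopes of radius \<open>2 t\<close>. The outer
  pair differs by at most \<open>2 a t\<close> in normal mean, and \<open>D\<close> applies to the inner pair.
\<close>

lemma smoothing_inequality:
  assumes "prob_space M" and W[measurable]: "W \<in> borel_measurable M"
    and H: "test_class H a" and "t > 0"
    and D: "\<And>h. h \<in> H \<Longrightarrow> \<bar>prob_space.expectation M (\<lambda>\<omega>. moving_average t h (W \<omega>))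
        - normal_expectation (moving_average t h)\<bar> \<le> D"
  shows "normal_distance M W H \<le> D + 2 * a * t"
proof -
  interpret prob_space M by fact
  have "\<bar>expectation (\<lambda>\<omega>. h (W \<omega>)) - normal_expectation h\<bar> \<le> D + 2 * a * t" if h: "h \<in> H" for h
  proof -
    let ?u = "upper_env t h" and ?l = "lower_env t h"
    let ?U = "upper_env (2 * t) h" and ?L = "lower_env (2 * t) h"
    have mem: "?u \<in> H" "?l \<in> H" "?U \<in> H" "?L \<in> H"
      using test_classD(3,4)[OF H h] \<open>t > 0\<close> by auto
    have meas[measurable]: "k \<in> borel_measurable borel" and bd: "\<bar>k x\<bar> \<le> 1" if "k \<in> H" for k x
      using test_classD(1,2)[OF H that] by auto
    have ma: "moving_average t k \<in> borel_measurable borel" "\<bar>moving_average t k x\<bar> \<le> 1" if "k \<in> H" for k x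
      using moving_average_bounded_borel[OF meas[OF that] bd[OF that] \<open>t > 0\<close>] by auto
    have intM: "integrable M (\<lambda>\<omega>. k (W \<omega>))" and intN: "integrable std_normal_distribution k"
      if "k \<in> H \<union> moving_average t ` H" for k
    proof -
      have k[measurable]: "k \<in> borel_measurable borel" and k1: "\<bar>k x\<bar> \<le> 1" for x
        using that meas bd ma by blast+
      show "integrable M (\<lambda>\<omega>. k (W \<omega>))"
        by (rule expectation_bounded(1)[OF assms(1) _ k1]) measurable
      show "integrable std_normal_distribution k"
        by (rule normal_expectation_bounded(1)[OF k k1])
    qed
    have up: "h x \<le> moving_average t ?u x" "moving_average t ?u x \<le> ?U x"
      and lo: "moving_average t ?l x \<le> h x" "?L x \<le> moving_average t ?l x" for x
    proof -
      have "h x \<le> ?u y \<and> ?u y \<le> ?U x" if y: "\<bar>y - x\<bar> \<le> t" for y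
      proof
        show "h x \<le> ?u y" using env_bounds(2)[of h x y t] bd[OF h] y by (simp add: abs_minus_commute)
        show "?u y \<le> ?U x"
          using \<open>t > 0\<close> y by (intro env_least(1) env_bounds(2) bd[OF h]) auto
      qed
      thus "h x \<le> moving_average t ?u x" "moving_average t ?u x \<le> ?U x"
        using moving_average_between[OF meas[OF mem(1)] bd[OF mem(1)] \<open>t > 0\<close>] by blast+
      have "?L x \<le> ?l y \<and> ?l y \<le> h x" if y: "\<bar>y - x\<bar> \<le> t" for y
      proof
        show "?l y \<le> h x" using env_bounds(1)[of h x y t] bd[OF h] y by (simp add: abs_minus_commute)
        show "?L x \<le> ?l y"
          using \<open>t > 0\<close> y by (intro env_least(2) env_bounds(1) bd[OF h]) auto
      qed
      thus "moving_average t ?l x \<le> h x" "?L x \<le> moving_average t ?l x"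
        using moving_average_between[OF meas[OF mem(2)] bd[OF mem(2)] \<open>t > 0\<close>] by blast+
    qed
    have mono: "normal_expectation k \<le> normal_expectation k'"
      if "k \<in> H \<union> moving_average t ` H" "k' \<in> H \<union> moving_average t ` H" "\<And>x. k x \<le> k' x" for k k'
      unfolding normal_expectation_def by (rule integral_mono) (use intN that in auto)
    have monoM: "expectation (\<lambda>\<omega>. k (W \<omega>)) \<le> expectation (\<lambda>\<omega>. k' (W \<omega>))"
      if "k \<in> H \<union> moving_average t ` H" "k' \<in> H \<union> moving_average t ` H" "\<And>x. k x \<le> k' x" for k k'
      by (rule integral_mono) (use intM that in auto)
    have "normal_expectation (\<lambda>x. ?U x - ?L x) = normal_expectation ?U - normal_expectation ?L"
      unfolding normal_expectation_def using intN mem by simp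
    hence gap: "normal_expectation ?U - normal_expectation ?L \<le> 2 * a * t"
      using test_classD(5)[OF H h, of "2 * t"] \<open>t > 0\<close> by simp
    have Nh: "normal_expectation ?L \<le> normal_expectation h" "normal_expectation h \<le> normal_expectation ?U"
      by (rule mono; use mem h env_bounds[of h _ _ "2 * t"] bd[OF h] \<open>t > 0\<close> in auto)+
    have "normal_expectation (moving_average t ?u) \<le> normal_expectation ?U"
      "normal_expectation ?L \<le> normal_expectation (moving_average t ?l)"
      by (rule mono; use mem up lo in auto)+
    moreover have "expectation (\<lambda>\<omega>. h (W \<omega>)) \<le> expectation (\<lambda>\<omega>. moving_average t ?u (W \<omega>))"
      "expectation (\<lambda>\<omega>. moving_average t ?l (W \<omega>)) \<le> expectation (\<lambda>\<omega>. h (W \<omega>))"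
      using monoM[of h "moving_average t ?u"] monoM[of "moving_average t ?l" h] h mem up lo by auto
    moreover note D[OF mem(1)] D[OF mem(2)] gap Nh
    ultimately show ?thesis by linarith
  qed
  moreover have "H \<noteq> {}" using H by (simp add: test_class_def)
  ultimately show ?thesis unfolding normal_distance_def by (intro cSUP_least)
qed

section \<open>The bound for a general test class\<close>

text \<open>
  The smoothing radius \<open>t\<close> stays free: it is taken proportional to \<open>A\<close> when \<open>A > 0\<close>, and tends to \<open>0\<close>
  in the degenerate case \<open>A = 0\<close>, where \<open>W\<close> and \<open>V\<close> coincide almost surely.
\<close>

lemma zero_bias_recursion:
  assumes "prob_space M" and [measurable]: "W \<in> borel_measurable M" "V \<in> borel_measurable M"
    and W2: "integrable M (\<lambda>\<omega>. (W \<omega>)\<^sup>2)" "prob_space.expectation M (\<lambda>\<omega>. (W \<omega>)\<^sup>2) = 1"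
    and zb: "\<And>f f' L K. \<lbrakk>\<And>x. (f has_real_derivative f' x) (at x); continuous_on UNIV f';
        \<And>x. \<bar>f' x\<bar> \<le> L; \<And>x. \<bar>f x\<bar> \<le> K\<rbrakk> \<Longrightarrow>
        prob_space.expectation M (\<lambda>\<omega>. W \<omega> * f (W \<omega>)) = prob_space.expectation M (\<lambda>\<omega>. f' (V \<omega>))"
    and close: "AE \<omega> in M. \<bar>V \<omega> - W \<omega>\<bar> \<le> A" and "A \<ge> 0" and "t > 0" and H: "test_class H a"
  shows "normal_distance M W H
    \<le> 14 * A + A / (2 * t) * (a * (t + A) + 2 * normal_distance M W H) + 2 * a * t"
proof (rule smoothing_inequality[OF assms(1,2) H \<open>t > 0\<close>])
  interpret prob_space M by fact
  fix h assume h: "h \<in> H"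
  note h_meas[measurable] = test_classD(1)[OF H h] and h1 = test_classD(2)[OF H h]
  let ?m = "moving_average t h" and ?r = "t + A"
  have r: "?r > 0" using \<open>A \<ge> 0\<close> \<open>t > 0\<close> by simp
  note m_meas[measurable] = moving_average_bounded_borel(1)[OF h_meas h1 \<open>t > 0\<close>]
  note m1 = moving_average_bounded_borel(2)[OF h_meas h1 \<open>t > 0\<close>]
  have u: "upper_env ?r h \<in> H" and l: "lower_env ?r h \<in> H" using test_classD(3,4)[OF H h r] .
  note [measurable] = test_classD(1)[OF H u] test_classD(1)[OF H l]
  have "\<bar>expectation (\<lambda>\<omega>. ?m (W \<omega>)) - normal_expectation ?m\<bar>
      \<le> 14 * A + expectation (\<lambda>\<omega>. \<bar>?m (W \<omega>) - ?m (V \<omega>)\<bar>)"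
    by (rule zero_bias_stein_bound[OF assms(1-5) zb close continuous_moving_average[OF h_meas h1 \<open>t > 0\<close>] m1])
  also have "expectation (\<lambda>\<omega>. \<bar>?m (W \<omega>) - ?m (V \<omega>)\<bar>)
      \<le> expectation (\<lambda>\<omega>. A / (2 * t) * (upper_env ?r h (W \<omega>) - lower_env ?r h (W \<omega>)))"
  proof (rule integral_mono_AE)
    show "AE \<omega> in M. \<bar>?m (W \<omega>) - ?m (V \<omega>)\<bar> \<le> A / (2 * t) * (upper_env ?r h (W \<omega>) - lower_env ?r h (W \<omega>))"
      using close by eventually_elim (rule moving_average_env_increment[OF h_meas h1 \<open>t > 0\<close>])
    show "integrable M (\<lambda>\<omega>. \<bar>?m (W \<omega>) - ?m (V \<omega>)\<bar>)"
    proof (rule expectation_bounded(1)[OF assms(1), where C = 2])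
      show "\<bar>\<bar>?m (W \<omega>) - ?m (V \<omega>)\<bar>\<bar> \<le> 2" for \<omega> using m1[of "W \<omega>"] m1[of "V \<omega>"] by linarith
    qed measurable
    have "integrable M (\<lambda>\<omega>. upper_env ?r h (W \<omega>))" "integrable M (\<lambda>\<omega>. lower_env ?r h (W \<omega>))"
      by (rule expectation_bounded(1)[OF assms(1), where C = 1];
          use test_classD(2)[OF H u] test_classD(2)[OF H l] in simp)+
    thus "integrable M (\<lambda>\<omega>. A / (2 * t) * (upper_env ?r h (W \<omega>) - lower_env ?r h (W \<omega>)))" by simp
  qed
  also have "\<dots> = A / (2 * t) * expectation (\<lambda>\<omega>. upper_env ?r h (W \<omega>) - lower_env ?r h (W \<omega>))" by simp
  also have "\<dots> \<le> A / (2 * t) * (a * ?r + 2 * normal_distance M W H)"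
    using test_class_envelope_gap[OF assms(1,2) H h r] \<open>A \<ge> 0\<close> \<open>t > 0\<close> by (intro mult_left_mono) auto
  finally show "\<bar>expectation (\<lambda>\<omega>. ?m (W \<omega>)) - normal_expectation ?m\<bar>
      \<le> 14 * A + A / (2 * t) * (a * ?r + 2 * normal_distance M W H)" by simp
qed

lemma zero_bias_normal_distance_bound:
  assumes "prob_space M" "W \<in> borel_measurable M" "V \<in> borel_measurable M"
    and "integrable M (\<lambda>\<omega>. (W \<omega>)\<^sup>2)" "prob_space.expectation M (\<lambda>\<omega>. (W \<omega>)\<^sup>2) = 1"
    and "\<And>f f' L K. \<lbrakk>\<And>x. (f has_real_derivative f' x) (at x); continuous_on UNIV f';
        \<And>x. \<bar>f' x\<bar> \<le> L; \<And>x. \<bar>f x\<bar> \<le> K\<rbrakk> \<Longrightarrow>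
        prob_space.expectation M (\<lambda>\<omega>. W \<omega> * f (W \<omega>)) = prob_space.expectation M (\<lambda>\<omega>. f' (V \<omega>))"
    and "AE \<omega> in M. \<bar>V \<omega> - W \<omega>\<bar> \<le> A" "A \<ge> 0" "test_class H a"
  shows "normal_distance M W H \<le> A * (28 + 19 / 2 * a)"
proof -
  let ?d = "normal_distance M W H"
  have a: "a \<ge> 0" by (rule test_class_constant_nonneg) fact
  have rec: "?d \<le> 14 * A + A / (2 * t) * (a * (t + A) + 2 * ?d) + 2 * a * t" if "t > 0" for t
    by (rule zero_bias_recursion[OF assms(1-8) that assms(9)])
  show ?thesis
  proof (cases "A = 0")
    case True
    have "?d \<le> 0 + e" if "e > 0" for e
    proof -
      have "?d \<le> 2 * a * (e / (2 * a + 1))" using rec[of "e / (2 * a + 1)"] True that a by simp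
      also have "\<dots> \<le> e" using a that by (simp add: field_simps)
      finally show ?thesis by simp
    qed
    hence "?d \<le> 0" by (rule field_le_epsilon)
    thus ?thesis using True by simp
  next
    case False
    hence "A > 0" using assms(8) by simp
    \<comment> \<open>For t = 2 A the right-hand side of the recursion contains half the normal distance.\<close>
    hence "A / (2 * (2 * A)) = 1 / 4" by simp
    with rec[of "2 * A"] \<open>A > 0\<close> have "?d \<le> 14 * A + 1 / 4 * (a * (2 * A + A) + 2 * ?d) + 2 * a * (2 * A)"
      by simp
    thus ?thesis by (simp add: algebra_simps)
  qed
qed

section \<open>Test classes of indicator functions\<close>

definition dilation :: "real \<Rightarrow> real set \<Rightarrow> real set" where
  "dilation \<epsilon> S = {x. \<exists>y\<in>S. \<bar>y - x\<bar> \<le> \<epsilon>}"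

definition erosion :: "real \<Rightarrow> real set \<Rightarrow> real set" where
  "erosion \<epsilon> S = {x. \<forall>y. \<bar>y - x\<bar> \<le> \<epsilon> \<longrightarrow> y \<in> S}"

lemma upper_env_indicator:
  assumes "\<epsilon> > 0"
  shows "upper_env \<epsilon> (indicat_real S) = indicat_real (dilation \<epsilon> S)"
proof
  fix x
  have le: "indicat_real S y \<le> upper_env \<epsilon> (indicat_real S) x" if "\<bar>y - x\<bar> \<le> \<epsilon>" for y
    by (rule env_bounds(2)[OF _ that]) (simp add: indicator_def)
  show "upper_env \<epsilon> (indicat_real S) x = indicat_real (dilation \<epsilon> S) x"
  proof (rule antisym)
    show "upper_env \<epsilon> (indicat_real S) x \<le> indicat_real (dilation \<epsilon> S) x"
      by (rule env_least(1)) (use assms in \<open>auto simp: dilation_def indicator_def\<close>)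
    show "indicat_real (dilation \<epsilon> S) x \<le> upper_env \<epsilon> (indicat_real S) x"
    proof (cases "x \<in> dilation \<epsilon> S")
      case True
      then obtain y where "y \<in> S" "\<bar>y - x\<bar> \<le> \<epsilon>" by (auto simp: dilation_def)
      thus ?thesis using le[of y] True by simp
    next
      case False
      thus ?thesis using order_trans[OF indicator_pos_le le[of x]] assms by simp
    qed
  qed
qed

lemma lower_env_indicator:
  assumes "\<epsilon> > 0"
  shows "lower_env \<epsilon> (indicat_real S) = indicat_real (erosion \<epsilon> S)"
proof
  fix x
  have le: "lower_env \<epsilon> (indicat_real S) x \<le> indicat_real S y" if "\<bar>y - x\<bar> \<le> \<epsilon>" for y
    by (rule env_bounds(1)[OF _ that]) (simp add: indicator_def)
  show "lower_env \<epsilon> (indicat_real S) x = indicat_real (erosion \<epsilon> S) x"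
  proof (rule antisym)
    show "indicat_real (erosion \<epsilon> S) x \<le> lower_env \<epsilon> (indicat_real S) x"
      by (rule env_least(2)) (use assms in \<open>auto simp: erosion_def indicator_def\<close>)
    show "lower_env \<epsilon> (indicat_real S) x \<le> indicat_real (erosion \<epsilon> S) x"
    proof (cases "x \<in> erosion \<epsilon> S")
      case True
      thus ?thesis using order_trans[OF le[of x] indicator_le_1] assms by simp
    next
      case False
      then obtain y where "y \<notin> S" "\<bar>y - x\<bar> \<le> \<epsilon>" by (auto simp: erosion_def)
      thus ?thesis using le[of y] False by simp
    qed
  qed
qed

text \<open>
  If the connected set \<open>[x - \<epsilon>, x + \<epsilon>]\<close> meets both \<open>S\<close> and its complement, then it meets the
  frontier of \<open>S\<close>.
\<close>

lemma dilation_minus_erosion_near_frontier: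
  "dilation \<epsilon> S - erosion \<epsilon> S \<subseteq> (\<Union>e\<in>frontier S. {e - \<epsilon>..e + \<epsilon>})"
proof
  fix x assume "x \<in> dilation \<epsilon> S - erosion \<epsilon> S"
  then obtain y z where yz: "y \<in> S" "z \<notin> S" "y \<in> {x - \<epsilon>..x + \<epsilon>}" "z \<in> {x - \<epsilon>..x + \<epsilon>}"
    by (auto simp: dilation_def erosion_def abs_le_iff)
  have "{x - \<epsilon>..x + \<epsilon>} \<inter> frontier S \<noteq> {}"
    by (rule connected_Int_frontier) (use yz in auto)
  thus "x \<in> (\<Union>e\<in>frontier S. {e - \<epsilon>..e + \<epsilon>})" by force
qed

lemma normal_expectation_ball_le:
  assumes "\<epsilon> > 0"
  shows "normal_expectation (indicat_real {e - \<epsilon>..e + \<epsilon>}) \<le> sqrt (2 / pi) * \<epsilon>"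
proof -
  let ?I = "{e - \<epsilon>..e + \<epsilon>}"
  have "normal_expectation (indicat_real ?I) = (LINT x|lborel. std_normal_density x * indicat_real ?I x)"
    by (rule normal_expectation_lborel) simp
  also have "\<dots> \<le> (LINT x|lborel. 1 / sqrt (2 * pi) * indicat_real ?I x)"
  proof (rule integral_mono)
    show "integrable lborel (\<lambda>x. std_normal_density x * indicat_real ?I x)"
      by (rule integrable_std_normal_density_mult[where C = 1]) (auto simp: indicator_def)
    show "integrable lborel (\<lambda>x. 1 / sqrt (2 * pi) * indicat_real ?I x)"
      by (intro integrable_mult_right integrable_real_indicator) (auto simp: emeasure_lborel_Icc_eq)
    have "std_normal_density x \<le> 1 / sqrt (2 * pi)" for x
      by (simp add: std_normal_density_def divide_right_mono)
    thus "std_normal_density x * indicat_real ?I x \<le> 1 / sqrt (2 * pi) * indicat_real ?I x" for x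
      by (intro mult_right_mono) auto
  qed
  also have "\<dots> = 2 * \<epsilon> / sqrt (2 * pi)" using assms by simp
  also have "\<dots> = sqrt (2 / pi) * \<epsilon>"
    by (simp add: real_sqrt_divide real_sqrt_mult field_simps)
  finally show ?thesis .
qed

text \<open>
  The constant of such a class counts frontier points: the envelope gap is the indicator of a set
  covered by one interval of radius \<open>\<epsilon>\<close> around each of them.
\<close>

lemma indicator_test_class:
  assumes ne: "\<S> \<noteq> {}" and borel: "\<And>S. S \<in> \<S> \<Longrightarrow> S \<in> sets borel"
    and affine: "\<And>S c d. S \<in> \<S> \<Longrightarrow> {x. c * x + d \<in> S} \<in> \<S>"
    and dil: "\<And>S \<epsilon>. S \<in> \<S> \<Longrightarrow> \<epsilon> > 0 \<Longrightarrow> dilation \<epsilon> S \<in> \<S>"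
    and ero: "\<And>S \<epsilon>. S \<in> \<S> \<Longrightarrow> \<epsilon> > 0 \<Longrightarrow> erosion \<epsilon> S \<in> \<S>"
    and front: "\<And>S. S \<in> \<S> \<Longrightarrow> finite (frontier S) \<and> card (frontier S) \<le> n"
  shows "test_class (indicat_real ` \<S>) (real n * sqrt (2 / pi))"
  unfolding test_class_def
proof (intro conjI ballI allI impI)
  show "indicat_real ` \<S> \<noteq> {}" using ne by simp
  show "indicat_real ` \<S> \<subseteq> borel_measurable borel" using borel by auto
  show "\<bar>h x\<bar> \<le> 1" if "h \<in> indicat_real ` \<S>" for h x using that by (auto simp: indicator_def)
  fix h assume "h \<in> indicat_real ` \<S>"
  then obtain S where h: "h = indicat_real S" and S: "S \<in> \<S>" by auto
  have "(\<lambda>x. h (c * x + d)) = indicat_real {x. c * x + d \<in> S}" for c d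
    by (auto simp: h indicator_def)
  thus "(\<lambda>x. h (c * x + d)) \<in> indicat_real ` \<S>" for c d using affine[OF S] by simp
  fix \<epsilon> :: real assume \<epsilon>: "\<epsilon> > 0"
  let ?D = "dilation \<epsilon> S" and ?E = "erosion \<epsilon> S"
  have u: "upper_env \<epsilon> h = indicat_real ?D" and l: "lower_env \<epsilon> h = indicat_real ?E"
    using upper_env_indicator[OF \<epsilon>] lower_env_indicator[OF \<epsilon>] h by auto
  show "upper_env \<epsilon> h \<in> indicat_real ` \<S>" "lower_env \<epsilon> h \<in> indicat_real ` \<S>"
    using dil[OF S \<epsilon>] ero[OF S \<epsilon>] u l by auto
  have fin: "finite (frontier S)" and card: "card (frontier S) \<le> n" using front[OF S] by auto
  have [measurable]: "?D \<in> sets borel" "?E \<in> sets borel" using borel dil ero S \<epsilon> by auto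
  let ?B = "\<lambda>e. indicat_real {e - \<epsilon>..e + \<epsilon>}"
  have "normal_expectation (\<lambda>x. upper_env \<epsilon> h x - lower_env \<epsilon> h x)
      \<le> normal_expectation (\<lambda>x. \<Sum>e\<in>frontier S. ?B e x)"
    unfolding normal_expectation_def
  proof (rule integral_mono)
    show "integrable std_normal_distribution (\<lambda>x. upper_env \<epsilon> h x - lower_env \<epsilon> h x)"
      unfolding u l
      by (rule normal_expectation_bounded(1)[where C = 1]) (measurable, auto simp: indicator_def)
    show "integrable std_normal_distribution (\<lambda>x. \<Sum>e\<in>frontier S. ?B e x)"
      by (intro Bochner_Integration.integrable_sum normal_expectation_bounded(1)[where C = 1])
         (auto simp: indicator_def)
    show "upper_env \<epsilon> h x - lower_env \<epsilon> h x \<le> (\<Sum>e\<in>frontier S. ?B e x)" for x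
    proof (cases "x \<in> ?D - ?E")
      case True
      then obtain e where e: "e \<in> frontier S" "x \<in> {e - \<epsilon>..e + \<epsilon>}"
        using dilation_minus_erosion_near_frontier[of \<epsilon> S] by blast
      have "upper_env \<epsilon> h x - lower_env \<epsilon> h x \<le> ?B e x" using e True by (simp add: u l)
      also have "\<dots> \<le> (\<Sum>e\<in>frontier S. ?B e x)" using fin e by (intro member_le_sum) auto
      finally show ?thesis .
    next
      case False
      hence "upper_env \<epsilon> h x - lower_env \<epsilon> h x \<le> 0" by (auto simp: u l indicator_def)
      also have "\<dots> \<le> (\<Sum>e\<in>frontier S. ?B e x)" by (intro sum_nonneg) auto
      finally show ?thesis .
    qed
  qed
  also have "\<dots> = (\<Sum>e\<in>frontier S. normal_expectation (?B e))"
    unfolding normal_expectation_def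
    by (rule Bochner_Integration.integral_sum, rule normal_expectation_bounded(1)[where C = 1])
       (auto simp: indicator_def)
  also have "\<dots> \<le> (\<Sum>e\<in>frontier S. sqrt (2 / pi) * \<epsilon>)"
    by (intro sum_mono normal_expectation_ball_le \<epsilon>)
  also have "\<dots> \<le> real n * sqrt (2 / pi) * \<epsilon>"
    using card \<epsilon> by (simp add: mult_right_mono mult.assoc)
  finally show "normal_expectation (\<lambda>x. upper_env \<epsilon> h x - lower_env \<epsilon> h x) \<le> real n * sqrt (2 / pi) * \<epsilon>" .
qed

section \<open>Half lines and intervals\<close>

definition extended_half_lines :: "real set set" where
  "extended_half_lines = range atMost \<union> range lessThan \<union> range atLeast \<union> range greaterThan \<union> {{}, UNIV}"

lemma extended_half_line_indicators_eq:
  "extended_half_line_indicators = indicat_real ` extended_half_lines"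
proof -
  have "indicat_real {} = (\<lambda>_::real. 0)" "indicat_real UNIV = (\<lambda>_::real. 1)" by auto
  hence "indicat_real ` {{}, UNIV} = {\<lambda>_::real. 0, \<lambda>_. 1}" by (simp only: image_insert image_empty)
  thus ?thesis
    unfolding extended_half_line_indicators_def half_line_indicators_def extended_half_lines_def
    by (simp only: image_Un image_image)
qed

lemma extended_half_lines_cases:
  assumes "S \<in> extended_half_lines"
  obtains z where "S = {..z}" | z where "S = {..<z}" | z where "S = {z..}" | z where "S = {z<..}"
    | "S = {}" | "S = UNIV"
  using assms unfolding extended_half_lines_def by blast

lemma extended_half_lines_memI [simp, intro]:
  "{..z} \<in> extended_half_lines" "{..<z} \<in> extended_half_lines" "{z..} \<in> extended_half_lines"
  "{z<..} \<in> extended_half_lines" "{} \<in> extended_half_lines" "UNIV \<in> extended_half_lines"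
  unfolding extended_half_lines_def by auto

lemma frontier_half_line:
  fixes z :: real
  shows "frontier {..z} = {z}" "frontier {..<z} = {z}" "frontier {z..} = {z}" "frontier {z<..} = {z}"
  by (auto simp: frontier_def interior_open)

lemma affine_preimage_half_line:
  assumes "S \<in> extended_half_lines"
  shows "{x. c * x + d \<in> S} \<in> extended_half_lines"
proof -
  consider "c = 0" | "c > 0" | "c < 0" by linarith
  thus ?thesis
  proof cases
    case 1
    hence "{x. c * x + d \<in> S} = (if d \<in> S then UNIV else {})" by auto
    thus ?thesis by simp
  next
    case 2
    hence "{x. c * x + d \<in> {..z}} = {..(z - d) / c}" "{x. c * x + d \<in> {..<z}} = {..<(z - d) / c}"
      "{x. c * x + d \<in> {z..}} = {(z - d) / c..}" "{x. c * x + d \<in> {z<..}} = {(z - d) / c<..}" for z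
      by (auto simp: field_simps)
    with assms show ?thesis by (cases rule: extended_half_lines_cases) auto
  next
    case 3
    hence "{x. c * x + d \<in> {..z}} = {(z - d) / c..}" "{x. c * x + d \<in> {..<z}} = {(z - d) / c<..}"
      "{x. c * x + d \<in> {z..}} = {..(z - d) / c}" "{x. c * x + d \<in> {z<..}} = {..<(z - d) / c}" for z
      by (auto simp: field_simps)
    with assms show ?thesis by (cases rule: extended_half_lines_cases) auto
  qed
qed

lemma dilation_half_line:
  assumes "\<epsilon> > 0" "S \<in> extended_half_lines"
  shows "dilation \<epsilon> S \<in> extended_half_lines"
proof -
  have minus: "x \<in> dilation \<epsilon> T" if "x - \<epsilon> \<in> T" for x T
    unfolding dilation_def using that assms(1) by (auto intro: bexI[of _ "x - \<epsilon>"])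
  have plus: "x \<in> dilation \<epsilon> T" if "x + \<epsilon> \<in> T" for x T
    unfolding dilation_def using that assms(1) by (auto intro: bexI[of _ "x + \<epsilon>"])
  have "dilation \<epsilon> {..z} \<subseteq> {..z + \<epsilon>}" "dilation \<epsilon> {..<z} \<subseteq> {..<z + \<epsilon>}"
    "dilation \<epsilon> {z..} \<subseteq> {z - \<epsilon>..}" "dilation \<epsilon> {z<..} \<subseteq> {z - \<epsilon><..}" for z
    unfolding dilation_def by auto
  moreover have "{..z + \<epsilon>} \<subseteq> dilation \<epsilon> {..z}" "{..<z + \<epsilon>} \<subseteq> dilation \<epsilon> {..<z}" for z
    by (auto intro!: minus)
  moreover have "{z - \<epsilon>..} \<subseteq> dilation \<epsilon> {z..}" "{z - \<epsilon><..} \<subseteq> dilation \<epsilon> {z<..}" for z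
    by (auto intro!: plus)
  ultimately have half: "dilation \<epsilon> {..z} = {..z + \<epsilon>}" "dilation \<epsilon> {..<z} = {..<z + \<epsilon>}"
    "dilation \<epsilon> {z..} = {z - \<epsilon>..}" "dilation \<epsilon> {z<..} = {z - \<epsilon><..}" for z
    by (simp_all add: subset_antisym)
  have triv: "dilation \<epsilon> {} = {}" "dilation \<epsilon> UNIV = UNIV"
    using plus[of _ UNIV] by (auto simp: dilation_def)
  show ?thesis using assms(2) by (cases rule: extended_half_lines_cases) (auto simp: half triv)
qed

lemma erosion_eq_dilation_Compl: "erosion \<epsilon> S = - dilation \<epsilon> (- S)"
  by (auto simp: erosion_def dilation_def)

lemma Compl_half_line:
  assumes "S \<in> extended_half_lines"
  shows "- S \<in> extended_half_lines"
  using assms by (cases rule: extended_half_lines_cases)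
    (auto simp: Compl_atMost Compl_lessThan Compl_atLeast Compl_greaterThan)

lemma test_class_half_lines: "test_class extended_half_line_indicators (sqrt (2 / pi))"
proof -
  have "test_class (indicat_real ` extended_half_lines) (real 1 * sqrt (2 / pi))"
  proof (rule indicator_test_class)
    show "extended_half_lines \<noteq> {}" by blast
    fix S assume S: "S \<in> extended_half_lines"
    thus "S \<in> sets borel" by (cases rule: extended_half_lines_cases) auto
    show "{x. c * x + d \<in> S} \<in> extended_half_lines" for c d by (rule affine_preimage_half_line[OF S])
    show "dilation \<epsilon> S \<in> extended_half_lines" if "\<epsilon> > 0" for \<epsilon> by (rule dilation_half_line[OF that S])
    show "erosion \<epsilon> S \<in> extended_half_lines" if "\<epsilon> > 0" for \<epsilon>
      unfolding erosion_eq_dilation_Compl by (intro Compl_half_line dilation_half_line that S)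
    show "finite (frontier S) \<and> card (frontier S) \<le> 1"
      using S by (cases rule: extended_half_lines_cases) (auto simp: frontier_half_line)
  qed
  thus ?thesis by (simp add: extended_half_line_indicators_eq)
qed

lemma real_interval_cases:
  fixes S :: "real set"
  assumes "is_interval S"
  obtains "S = {}" | "S = UNIV" | b where "S = {..<b}" | b where "S = {..b}" | a where "S = {a<..}"
    | a where "S = {a..}" | a b where "S = {a<..<b}" | a b where "S = {a<..b}"
    | a b where "S = {a..<b}" | a b where "S = {a..b}"
proof -
  have "x \<in> S" if "a \<in> S" "b \<in> S" "a \<le> x" "x \<le> b" for a b x
    using assms that unfolding is_interval_1 by blast
  hence "\<exists>a b. S = {} \<or> S = UNIV \<or> S = {..<b} \<or> S = {..b} \<or> S = {a<..} \<or> S = {a..} \<or>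
      S = {a<..<b} \<or> S = {a<..b} \<or> S = {a..<b} \<or> S = {a..b}"
    by (rule interval_cases)
  thus thesis using that by (elim exE disjE)
qed

lemma frontier_bounded_interval_subset:
  fixes a b :: real
  assumes "{a<..<b} \<subseteq> S" "S \<subseteq> {a..b}"
  shows "frontier S \<subseteq> {a, b}"
proof -
  have "closure S \<subseteq> {a..b}" by (rule closure_minimal) (use assms in auto)
  moreover have "{a<..<b} \<subseteq> interior S" by (rule interior_maximal) (use assms in auto)
  ultimately show ?thesis unfolding frontier_def by force
qed

lemma frontier_interval:
  fixes S :: "real set"
  assumes "is_interval S"
  shows "finite (frontier S) \<and> card (frontier S) \<le> 2"
proof -
  have "\<exists>a b. frontier S \<subseteq> {a, b}"
    using assms
  proof (cases rule: real_interval_cases)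
    case (7 a b) thus ?thesis
      by (intro exI[of _ a] exI[of _ b] frontier_bounded_interval_subset) auto
  next
    case (8 a b) thus ?thesis
      by (intro exI[of _ a] exI[of _ b] frontier_bounded_interval_subset) auto
  next
    case (9 a b) thus ?thesis
      by (intro exI[of _ a] exI[of _ b] frontier_bounded_interval_subset) auto
  next
    case (10 a b) thus ?thesis
      by (intro exI[of _ a] exI[of _ b] frontier_bounded_interval_subset) auto
  qed (auto simp: frontier_half_line)
  then obtain a b where ab: "frontier S \<subseteq> {a, b}" by blast
  have "card (frontier S) \<le> card {a, b}" by (rule card_mono) (use ab in auto)
  also have "\<dots> \<le> 2" by (simp add: card_insert_if)
  finally show ?thesis using ab by (auto intro: finite_subset)
qed

lemma is_interval_affine_preimage:
  fixes S :: "real set"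
  assumes "is_interval S"
  shows "is_interval {x. c * x + d \<in> S}"
  unfolding is_interval_1
proof (intro ballI allI impI, elim conjE)
  fix a b x assume *: "a \<in> {x. c * x + d \<in> S}" "b \<in> {x. c * x + d \<in> S}" "a \<le> x" "x \<le> b"
  have "c * a + d \<le> c * x + d \<and> c * x + d \<le> c * b + d \<or> c * b + d \<le> c * x + d \<and> c * x + d \<le> c * a + d"
    using *(3,4) by (cases "c \<ge> 0") (auto intro: mult_left_mono mult_left_mono_neg)
  thus "x \<in> {x. c * x + d \<in> S}"
    using *(1,2) assms unfolding is_interval_1 by blast
qed

text \<open>
  A point between two points of the dilation either lies between their partners in \<open>S\<close>, and then is
  in \<open>S\<close> itself, or is at least as close to one of the partners as the corresponding end point.
\<close>

lemma is_interval_dilation: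
  assumes "is_interval S"
  shows "is_interval (dilation \<epsilon> S)"
  unfolding is_interval_1
proof (intro ballI allI impI, elim conjE)
  fix a b x assume "a \<in> dilation \<epsilon> S" "b \<in> dilation \<epsilon> S" and x: "a \<le> x" "x \<le> b"
  then obtain a' b' where ab: "a' \<in> S" "\<bar>a' - a\<bar> \<le> \<epsilon>" "b' \<in> S" "\<bar>b' - b\<bar> \<le> \<epsilon>"
    by (auto simp: dilation_def)
  consider "x \<le> a'" | "b' \<le> x" | "a' \<le> x" "x \<le> b'" by linarith
  thus "x \<in> dilation \<epsilon> S"
  proof cases
    case 1
    hence "\<bar>a' - x\<bar> \<le> \<epsilon>" using x ab by linarith
    thus ?thesis using ab by (auto simp: dilation_def)
  next
    case 2
    hence "\<bar>b' - x\<bar> \<le> \<epsilon>" using x ab by linarith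
    thus ?thesis using ab by (auto simp: dilation_def)
  next
    case 3
    hence "x \<in> S" using assms ab unfolding is_interval_1 by blast
    moreover have "\<bar>x - x\<bar> \<le> \<epsilon>" using ab by linarith
    ultimately show ?thesis unfolding dilation_def by blast
  qed
qed

lemma is_interval_erosion:
  assumes "is_interval S"
  shows "is_interval (erosion \<epsilon> S)"
  unfolding is_interval_1
proof (intro ballI allI impI, elim conjE)
  fix a b x assume ab: "a \<in> erosion \<epsilon> S" "b \<in> erosion \<epsilon> S" and x: "a \<le> x" "x \<le> b"
  have "y \<in> S" if y: "\<bar>y - x\<bar> \<le> \<epsilon>" for y
  proof -
    have "a + (y - x) \<in> S" "b + (y - x) \<in> S" using ab y by (auto simp: erosion_def)
    moreover have "a + (y - x) \<le> y" "y \<le> b + (y - x)" using x by linarith+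
    ultimately show ?thesis using assms unfolding is_interval_1 by blast
  qed
  thus "x \<in> erosion \<epsilon> S" by (simp add: erosion_def)
qed

lemma test_class_intervals: "test_class interval_indicators (2 * sqrt (2 / pi))"
proof -
  have "test_class (indicat_real ` {S. is_interval S}) (real 2 * sqrt (2 / pi))"
  proof (rule indicator_test_class)
    show "{S. is_interval (S :: real set)} \<noteq> {}" using is_interval_univ by blast
    fix S :: "real set" assume "S \<in> {S. is_interval S}"
    hence S: "is_interval S" by simp
    thus "S \<in> sets borel" by (cases rule: real_interval_cases) auto
    show "{x. c * x + d \<in> S} \<in> {S. is_interval S}" for c d
      using is_interval_affine_preimage[OF S] by simp
    show "dilation \<epsilon> S \<in> {S. is_interval S}" "erosion \<epsilon> S \<in> {S. is_interval S}" for \<epsilon>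
      using is_interval_dilation[OF S] is_interval_erosion[OF S] by auto
    show "finite (frontier S) \<and> card (frontier S) \<le> 2" by (rule frontier_interval[OF S])
  qed
  moreover have "interval_indicators = indicat_real ` {S. is_interval S}"
    by (auto simp: interval_indicators_def)
  ultimately show ?thesis by simp
qed

lemma sqrt_2_over_pi_le_1: "sqrt (2 / pi) \<le> 1"
  using pi_ge_two by (simp add: real_sqrt_le_1_iff)

section \<open>The normal approximation bounds\<close>

theorem theorem1p1:
  fixes M :: "'a measure" and Y Ys :: "'a \<Rightarrow> real" and \<sigma> B A :: real and W :: "'a \<Rightarrow> real"
  assumes "prob_space M"
    and "Y \<in> borel_measurable M"
    and "integrable M Y" and "integrable M (\<lambda>\<omega>. (Y \<omega>)\<^sup>2)"
    and "prob_space.expectation M Y = 0"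
    and "\<sigma> > 0" and "prob_space.variance M Y = \<sigma>\<^sup>2"
    and "zero_biased M Y Ys"
    and "AE \<omega> in M. \<bar>Ys \<omega> - Y \<omega>\<bar> \<le> 2 * B"
    and "B \<le> \<sigma> / 24"
  defines "W \<equiv> \<lambda>\<omega>. Y \<omega> / \<sigma>" and "A \<equiv> 2 * B / \<sigma>"
  shows "(\<forall>H a. test_class H a \<longrightarrow> normal_distance M W H \<le> A * (37 + 12 * A + 112 * a)) \<and>
         (test_class extended_half_line_indicators (sqrt (2 / pi)) \<and>
          normal_distance M W half_line_indicators \<le> A * (127 + 12 * A)) \<and>
         (test_class interval_indicators (2 * sqrt (2 / pi)) \<and>
          normal_distance M W interval_indicators \<le> A * (216 + 12 * A))"
proof -
  interpret prob_space M by fact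
  note [measurable] = assms(2)
  have Ys: "Ys \<in> borel_measurable M" using assms(8) by (simp add: zero_biased_def)
  note [measurable] = Ys
  have "AE \<omega> in M. 0 \<le> 2 * B" using assms(9) by eventually_elim linarith
  hence "B \<ge> 0" by simp
  hence "A \<ge> 0" using assms(6) by (simp add: A_def)
  have "expectation (\<lambda>\<omega>. (Y \<omega>)\<^sup>2) = \<sigma>\<^sup>2" using assms(5,7) by simp
  hence W2: "expectation (\<lambda>\<omega>. (W \<omega>)\<^sup>2) = 1" using assms(6) by (simp add: W_def power_divide)
  have close: "AE \<omega> in M. \<bar>Ys \<omega> / \<sigma> - W \<omega>\<bar> \<le> A"
    using assms(9)
  proof eventually_elim
    case (elim \<omega>)
    thus ?case using assms(6) by (simp add: W_def A_def divide_right_mono flip: diff_divide_distrib)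
  qed
  have W_meas: "W \<in> borel_measurable M" unfolding W_def by measurable
  have bound: "normal_distance M W H \<le> A * (28 + 19 / 2 * a)" if H: "test_class H a" for H a
  proof (rule zero_bias_normal_distance_bound[OF assms(1) W_meas _ _ W2 _ close \<open>A \<ge> 0\<close> H])
    show "(\<lambda>\<omega>. Ys \<omega> / \<sigma>) \<in> borel_measurable M" by measurable
    show "integrable M (\<lambda>\<omega>. (W \<omega>)\<^sup>2)" using assms(4) by (simp add: W_def power_divide)
    show "expectation (\<lambda>\<omega>. W \<omega> * f (W \<omega>)) = expectation (\<lambda>\<omega>. f' (Ys \<omega> / \<sigma>))"
      if "\<And>x. (f has_real_derivative f' x) (at x)" "continuous_on UNIV f'"
        "\<And>x. \<bar>f' x\<bar> \<le> L" "\<And>x. \<bar>f x\<bar> \<le> K" for f f' L K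
      unfolding W_def by (rule zero_biased_rescaled[OF assms(1-3,8,6,7) that])
  qed
  have weaken: "A * (28 + 19 / 2 * a) \<le> A * (c + 12 * A)" if "28 + 19 / 2 * a \<le> c" for a c
    using that \<open>A \<ge> 0\<close> by (intro mult_left_mono) auto
  have "normal_distance M W H \<le> A * (37 + 12 * A + 112 * a)" if H: "test_class H a" for H a
  proof -
    have "A * (28 + 19 / 2 * a) \<le> A * (37 + 112 * a + 12 * A)"
      using test_class_constant_nonneg[OF H] by (intro weaken) simp
    thus ?thesis using bound[OF H] by (simp add: add_ac)
  qed
  moreover have "normal_distance M W half_line_indicators \<le> A * (127 + 12 * A)"
  proof -
    have "normal_distance M W half_line_indicators \<le> normal_distance M W extended_half_line_indicators"
      unfolding normal_distance_def[of M W half_line_indicators]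
    proof (rule cSUP_least)
      show "half_line_indicators \<noteq> {}" by (simp add: half_line_indicators_def)
      fix h assume "h \<in> half_line_indicators"
      hence "h \<in> extended_half_line_indicators" by (simp add: extended_half_line_indicators_def)
      thus "\<bar>expectation (\<lambda>\<omega>. h (W \<omega>)) - normal_expectation h\<bar>
          \<le> normal_distance M W extended_half_line_indicators"
        by (rule test_class_deviation_le_normal_distance[OF assms(1) W_meas test_class_half_lines])
    qed
    also have "\<dots> \<le> A * (28 + 19 / 2 * sqrt (2 / pi))" by (rule bound[OF test_class_half_lines])
    also have "\<dots> \<le> A * (127 + 12 * A)" using sqrt_2_over_pi_le_1 by (intro weaken) linarith
    finally show ?thesis .
  qed
  moreover have "normal_distance M W interval_indicators \<le> A * (216 + 12 * A)"
  proof -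
    have "A * (28 + 19 / 2 * (2 * sqrt (2 / pi))) \<le> A * (216 + 12 * A)"
      using sqrt_2_over_pi_le_1 by (intro weaken) linarith
    thus ?thesis using bound[OF test_class_intervals] by linarith
  qed
  ultimately show ?thesis using test_class_half_lines test_class_intervals by blast
qed

end
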